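(* Let $d,n\in\mathbb{N}$ with $d\ge 50$. Then: (1) if $2d\mid n$, then $m(n,2^{d-1}-d)=\frac{2^d-d-\frac12}{d}\,n$, and hence $m(2^{d-1}-d)=\frac{2^d-d-\frac12}{d}$; (2) for every $1\le c\le d-1$, if $d\mid n$, then $m(n,2^{d-1}-c)=\frac{2^d-c}{d}\,n$, and hence $m(2^{d-1}-c)=\frac{2^d-c}{d}$.
   Context: For non-negative integers $n,m,a,b$ write $(n,m)\to(a,b)$ if for every $n$-element set $V$ and every family $\mathcal{F}\subseteq 2^{V}$ with $|\mathcal{F}|\ge m$ there is an $a$-element set $T\subseteq V$ with $|\mathcal{F}_{|T}|\ge b$, where $\mathcal{F}_{|T}=\{F\cap T: F\in\mathcal{F}\}$. For non-negative integers $n,s$, $m(n,s)$ denotes the maximum integer $m$ such that $(n,m)\to(n-1,m-s)$. For fixed $s$, $m(s)=\lim_{n\to\infty} m(n,s)/n$ (this limit exists). *)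

theory Defs
  imports Complex_Main
begin

definition trace :: "nat set set \<Rightarrow> nat set \<Rightarrow> nat set set" where
  "trace F T = (\<lambda>A. A \<inter> T) ` F"

text \<open>(n,m) \<rightarrow> (a,b): for every n-element set V and every family F of subsets of V with
  at least m members there is an a-element T \<subseteq> V with at least b traces on T.
  Ground sets are taken as finite sets of naturals (the property is invariant under bijection).\<close>
definition arrow :: "nat \<Rightarrow> nat \<Rightarrow> nat \<Rightarrow> nat \<Rightarrow> bool" where
  "arrow n m a b \<longleftrightarrow>
     (\<forall>V :: nat set. \<forall>F :: nat set set.
        finite V \<and> card V = n \<and> F \<subseteq> Pow V \<and> card F \<ge> m \<longrightarrow>
        (\<exists>T. T \<subseteq> V \<and> card T = a \<and> card (trace F T) \<ge> b))"

text \<open>m(n,s): maximum m (among the meaningful values m \<le> 2^n; larger m make the arrow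
  vacuously true) with (n,m) \<rightarrow> (n-1, m-s). Subtraction m-s is truncated, which matches
  the intended meaning (a negative bound is trivially satisfied).\<close>
definition mfun :: "nat \<Rightarrow> nat \<Rightarrow> nat" where
  "mfun n s = (GREATEST m. m \<le> 2 ^ n \<and> arrow n m (n - 1) (m - s))"

end

theory Submission
  imports Defs "HOL-Analysis.Henstock_Kurzweil_Integration"
begin

text \<open>
Down-compression does not increase traces, and deleting a point x from a hereditary family costs
exactly its degree; so m(n,s) + 1 is the least size of a hereditary family on n points all of whose
degrees exceed s. Distributing each nonempty set evenly over its points, one has to bound the
average of the weights w(x), the sum of 1 / (|A| + 1) over the members A of the link of x.

For a hereditary family L the generating function satisfies
\<Sum>A\<in>L. t ^ |A| \<ge> |L| powr log 2 (1 + t) on the unit interval; integrating chords of this concave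
bound shows that a link with at least d points has weight at least (2 ^ d - c) / d. A point whose
link has exactly d - 1 points spans a d-element block which contains all sets through it. Counting
the missing subsets of a block against the sets that leave it shows that the average weight on a
block is large enough, except for a loss of 1/2 per block when c = d. Points in several
blocks have so much weight that they pay for all of them, and the remaining blocks are disjoint.
Equality is attained by disjoint blocks, paired up by an edge when c = d.
\<close>

section \<open>Generating functions of hereditary families\<close>

text \<open>A link has at least 2^(d-1) - (c-1) members, and the top sets of a (d-1)-cube weigh
  about 1/d, which explains the target (2^d - c)/d per point. The concave bound charges
  \<open>om (d - 2)\<close>, about 2/d, for each missing set and may overcharge by almost 1; a link
  with a spare point earns this back when a point of low degree is deleted. A link on exactly d - 1
  points can really fall short, because a missing set below the top weighs more than 1/d. Summed
  over a block, however, a missing set costs exactly 1 whatever its size. It remains to see how a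
  block can miss more than c - 1 sets. Missing sets are closed upwards, and each point without sets
  leaving the block must then be avoided by one of them, which forces the top and one coatom per
  such point. Such a point lies in fewer than c missing sets, so at least d - c + 1 points have sets
  leaving the block, each worth at least 1/2. For c < d these are two or more and pay for one extra
  missing set; for c = d there may be only one, which is the origin of the 1/2.\<close>

definition hereditary :: "'a set set \<Rightarrow> bool" where
  "hereditary F \<longleftrightarrow> (\<forall>A\<in>F. \<forall>B. B \<subseteq> A \<longrightarrow> B \<in> F)"

definition link :: "'a set set \<Rightarrow> 'a \<Rightarrow> 'a set set" where
  "link F x = {A. x \<notin> A \<and> insert x A \<in> F}"

definition del :: "'a set set \<Rightarrow> 'a \<Rightarrow> 'a set set" where
  "del F x = {A \<in> F. x \<notin> A}"

definition mass :: "nat \<Rightarrow> 'a set set \<Rightarrow> real" where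
  "mass j F = (\<Sum>A\<in>F. 1 / real (card A + j))"

lemma hereditaryD: "hereditary F \<Longrightarrow> A \<in> F \<Longrightarrow> B \<subseteq> A \<Longrightarrow> B \<in> F"
  unfolding hereditary_def by blast

lemma hereditary_empty_mem: "hereditary F \<Longrightarrow> F \<noteq> {} \<Longrightarrow> {} \<in> F"
  unfolding hereditary_def by blast

lemma hereditary_del: "hereditary F \<Longrightarrow> hereditary (del F x)"
  unfolding hereditary_def del_def by blast

lemma hereditary_link: "hereditary F \<Longrightarrow> hereditary (link F x)"
  unfolding hereditary_def link_def
  by (smt (verit, best) insert_mono mem_Collect_eq subset_iff)

lemma link_eq_image: "link F x = (\<lambda>A. A - {x}) ` {A \<in> F. x \<in> A}"
proof
  show "link F x \<subseteq> (\<lambda>A. A - {x}) ` {A \<in> F. x \<in> A}"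
  proof
    fix A assume "A \<in> link F x"
    then have "A = insert x A - {x}" "insert x A \<in> {A \<in> F. x \<in> A}"
      unfolding link_def by auto
    then show "A \<in> (\<lambda>A. A - {x}) ` {A \<in> F. x \<in> A}" by blast
  qed
qed (auto simp: link_def insert_absorb)

lemma finite_link: "finite F \<Longrightarrow> finite (link F x)"
  unfolding link_eq_image by simp

lemma finite_del: "finite F \<Longrightarrow> finite (del F x)"
  unfolding del_def by simp

lemma link_subset_Pow: "F \<subseteq> Pow Y \<Longrightarrow> link F x \<subseteq> Pow (Y - {x})"
  unfolding link_def by blast

lemma del_subset_Pow: "F \<subseteq> Pow Y \<Longrightarrow> del F x \<subseteq> Pow (Y - {x})"
  unfolding del_def by blast

lemma link_subset_del: "hereditary F \<Longrightarrow> link F x \<subseteq> del F x"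
  unfolding hereditary_def link_def del_def by blast

lemma inj_on_insert_link: "inj_on (insert x) (link F x)"
  unfolding inj_on_def link_def by (metis (mono_tags, lifting) Diff_insert_absorb mem_Collect_eq)

lemma insert_image_link: "insert x ` link F x = {A \<in> F. x \<in> A}"
proof
  show "{A \<in> F. x \<in> A} \<subseteq> insert x ` link F x"
  proof
    fix A assume "A \<in> {A \<in> F. x \<in> A}"
    then have "A = insert x (A - {x})" "A - {x} \<in> link F x"
      unfolding link_def by (auto simp: insert_absorb)
    then show "A \<in> insert x ` link F x" by blast
  qed
qed (auto simp: link_def)

lemma card_link: "card (link F x) = card {A \<in> F. x \<in> A}"
  by (metis card_image inj_on_insert_link insert_image_link)

lemma sum_del_link:
  fixes f :: "'a set \<Rightarrow> 'b::comm_monoid_add"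
  assumes "finite F"
  shows "(\<Sum>A\<in>F. f A) = (\<Sum>A\<in>del F x. f A) + (\<Sum>A\<in>link F x. f (insert x A))"
proof -
  have "F = del F x \<union> {A \<in> F. x \<in> A}" unfolding del_def by blast
  moreover have "del F x \<inter> {A \<in> F. x \<in> A} = {}" unfolding del_def by blast
  ultimately have "sum f F = sum f (del F x) + sum f {A \<in> F. x \<in> A}"
    by (metis (no_types, lifting) assms finite_Un sum.union_disjoint)
  also have "sum f {A \<in> F. x \<in> A} = (\<Sum>A\<in>link F x. f (insert x A))"
    unfolding insert_image_link[symmetric] by (subst sum.reindex[OF inj_on_insert_link]) simp
  finally show ?thesis .
qed

lemma card_del_link: "finite F \<Longrightarrow> card F = card (del F x) + card (link F x)"
  using sum_del_link[of F "\<lambda>_. 1::nat" x] by simp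

lemma card_insert_link: "finite Y \<Longrightarrow> F \<subseteq> Pow Y \<Longrightarrow> A \<in> link F x \<Longrightarrow> card (insert x A) = Suc (card A)"
  unfolding link_def by (auto intro!: card_insert_disjoint intro: finite_subset)

lemma mass_del_link:
  assumes "finite Y" "F \<subseteq> Pow Y"
  shows "mass j F = mass j (del F x) + mass (Suc j) (link F x)"
proof -
  have "finite F" using assms finite_subset by blast
  then show ?thesis
    unfolding mass_def sum_del_link[of F "\<lambda>A. 1 / real (card A + j)" x, OF \<open>finite F\<close>]
    using card_insert_link[OF assms] by (auto intro!: sum.cong)
qed

section \<open>Concavity and lower bounds for generating functions\<close>

lemma concave_on_powr:
  assumes "0 \<le> p" "p \<le> (1::real)"
  shows "concave_on {0<..} (\<lambda>x. x powr p)"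
proof (rule f''_le0_imp_concave)
  show "convex {(0::real)<..}" by simp
  fix x :: real assume x: "x \<in> {0<..}"
  show "((\<lambda>x. x powr p) has_real_derivative p * x powr (p - 1)) (at x)"
    using x by (auto intro!: derivative_eq_intros)
  show "((\<lambda>x. p * x powr (p - 1)) has_real_derivative p * ((p - 1) * x powr (p - 1 - 1))) (at x)"
    using x by (auto intro!: derivative_eq_intros)
  show "p * ((p - 1) * x powr (p - 1 - 1)) \<le> 0"
    using assms by (simp add: mult_nonneg_nonpos mult_nonpos_nonneg)
qed

text \<open>Since \<open>a + 2 * b = (a + b) + b\<close> and both \<open>a\<close> and
  \<open>2 * b\<close> lie between \<open>b\<close> and \<open>a + b\<close>, they are convex
  combinations of these endpoints with complementary weights; adding the two concavity inequalities
  gives the claim. Equality at \<open>a = b\<close> is what makes cubes extremal.\<close>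

lemma powr_add_le:
  fixes a b p :: real
  assumes "0 \<le> p" "p \<le> 1" "0 < b" "b \<le> a"
  shows "(a + b) powr p \<le> a powr p + (2 powr p - 1) * b powr p"
proof -
  let ?g = "\<lambda>x::real. x powr p"
  let ?u = "(a - b) / a" and ?v = "b / a"
  have a: "a > 0" using assms by simp
  have uv: "0 \<le> ?u" "0 \<le> ?v" "?u + ?v = 1" "?v + ?u = 1"
    using assms a by (auto simp: field_simps)
  have e1: "?u *\<^sub>R (a + b) + ?v *\<^sub>R b = a" "?v *\<^sub>R (a + b) + ?u *\<^sub>R b = 2 * b"
    using a by (auto simp: field_simps)
  note C = concave_on_powr[OF assms(1,2), unfolded concave_on_iff]
  have 1: "?g a \<ge> ?u * ?g (a + b) + ?v * ?g b"
    using C uv assms a e1 by (metis (no_types, lifting) add_pos_pos greaterThan_iff)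
  have 2: "?g (2 * b) \<ge> ?v * ?g (a + b) + ?u * ?g b"
    using C uv assms a e1 by (metis (no_types, lifting) add_pos_pos greaterThan_iff)
  have "?u * ?g (a + b) + ?v * ?g b + (?v * ?g (a + b) + ?u * ?g b) = (?u + ?v) * ?g (a + b) + (?u + ?v) * ?g b"
    by (simp only: algebra_simps)
  also have "\<dots> = ?g (a + b) + ?g b" unfolding uv(3) by simp
  finally have "?g (a + b) + ?g b \<le> ?g a + ?g (2 * b)" using 1 2 by linarith
  moreover have "?g (2 * b) = 2 powr p * ?g b" using assms by (simp add: powr_mult)
  ultimately show ?thesis by (simp add: algebra_simps)
qed

lemma log_one_plus_bounds:
  fixes x :: real
  assumes "0 \<le> x" "x \<le> 1"
  shows "0 \<le> log 2 (1 + x)" "log 2 (1 + x) \<le> 1" "2 powr log 2 (1 + x) = 1 + x"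
  using assms by (auto simp: le_log_iff log_le_iff)

text \<open>Equality holds for the cubes; the induction removes one point, and concavity of the power
  function handles the resulting two-term inequality.\<close>
lemma generating_function_ge:
  fixes x :: real
  assumes "finite Y" "F \<subseteq> Pow Y" "hereditary F" "0 \<le> x" "x \<le> 1"
  shows "real (card F) powr log 2 (1 + x) \<le> (\<Sum>A\<in>F. x ^ card A)"
  using assms(1-3)
proof (induction Y arbitrary: F rule: finite_induct)
  case empty
  then have "F = {} \<or> F = {{}}" by (auto simp: subset_singleton_iff)
  then show ?case by auto
next
  case (insert y Y)
  let ?p = "log 2 (1 + x)"
  note p = log_one_plus_bounds[OF assms(4,5)]
  have fin: "finite (insert y Y)" using insert by simp
  have fF: "finite F" using insert.prems fin finite_subset by blast
  have sd: "del F y \<subseteq> Pow Y" and sl: "link F y \<subseteq> Pow Y"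
    using del_subset_Pow[OF insert.prems(1), of y] link_subset_Pow[OF insert.prems(1), of y] by auto
  have IHd: "real (card (del F y)) powr ?p \<le> (\<Sum>A\<in>del F y. x ^ card A)"
    using insert.IH[OF sd hereditary_del] insert.prems by blast
  have IHl: "real (card (link F y)) powr ?p \<le> (\<Sum>A\<in>link F y. x ^ card A)"
    using insert.IH[OF sl hereditary_link] insert.prems by blast
  have eq: "(\<Sum>A\<in>F. x ^ card A) = (\<Sum>A\<in>del F y. x ^ card A) + x * (\<Sum>A\<in>link F y. x ^ card A)"
    unfolding sum_del_link[OF fF, of _ y] sum_distrib_left
    using card_insert_link[OF fin insert.prems(1)] by (auto intro!: sum.cong)
  have le: "card (link F y) \<le> card (del F y)"
    by (intro card_mono finite_del fF link_subset_del insert.prems)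
  have "real (card F) powr ?p \<le> real (card (del F y)) powr ?p + x * real (card (link F y)) powr ?p"
  proof (cases "card (link F y) = 0")
    case True
    then show ?thesis using card_del_link[OF fF, of y] assms(4) by simp
  next
    case False
    have "(real (card (del F y)) + real (card (link F y))) powr ?p
        \<le> real (card (del F y)) powr ?p + (2 powr ?p - 1) * real (card (link F y)) powr ?p"
      using p le False by (intro powr_add_le) auto
    then show ?thesis using card_del_link[OF fF, of y] p(3) by simp
  qed
  also have "\<dots> \<le> (\<Sum>A\<in>del F y. x ^ card A) + x * (\<Sum>A\<in>link F y. x ^ card A)"
    using IHd IHl assms(4) by (intro add_mono mult_left_mono)
  finally show ?case unfolding eq .
qed

lemma power_two_powr_log:
  fixes x :: real
  assumes "0 \<le> x" "x \<le> 1"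
  shows "(2 ^ k) powr log 2 (1 + x) = (1 + x) ^ k"
proof -
  have "(2 ^ k) powr log 2 (1 + x) = (2 powr log 2 (1 + x)) ^ k"
    by (simp add: powr_powr powr_realpow[symmetric] mult.commute)
  then show ?thesis using log_one_plus_bounds[OF assms] by simp
qed

text \<open>A ratio r <= 1 satisfies r <= r powr p for p <= 1: this is the chord of the concave
  bound from 0 to \<open>2 ^ k\<close>.\<close>

lemma generating_function_ge_linear:
  fixes x :: real
  assumes "finite Y" "F \<subseteq> Pow Y" "hereditary F" "0 \<le> x" "x \<le> 1" "card F \<le> 2 ^ k"
  shows "real (card F) * ((1 + x) / 2) ^ k \<le> (\<Sum>A\<in>F. x ^ card A)"
proof (cases "card F = 0")
  case True
  then show ?thesis using assms by (simp add: sum_nonneg)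
next
  case False
  let ?p = "log 2 (1 + x)" and ?r = "real (card F) / 2 ^ k"
  note p = log_one_plus_bounds[OF assms(4,5)]
  have r: "0 < ?r" "?r \<le> 1" using False assms(6) by (auto simp: field_simps)
  have "?r \<le> ?r powr ?p"
    using powr_mono'[of ?p 1 ?r] p r by simp
  then have "?r * (1 + x) ^ k \<le> ?r powr ?p * (1 + x) ^ k"
    using assms by (intro mult_right_mono) auto
  also have "\<dots> = (?r * 2 ^ k) powr ?p"
    using power_two_powr_log[OF assms(4,5), of k] r by (simp only: powr_mult)
  also have "\<dots> = real (card F) powr ?p" by simp
  finally show ?thesis
    using generating_function_ge[OF assms(1-5)] by (simp add: power_divide)
qed

text \<open>The chord from \<open>2 ^ k\<close> to \<open>2 ^ Suc k\<close>, written from its upper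
  end: each set short of the full cube costs the slope \<open>x * ((1 + x) / 2) ^ k\<close>, the
  integrand of \<open>om\<close>.\<close>

lemma generating_function_ge_chord:
  fixes x :: real
  assumes "finite Y" "F \<subseteq> Pow Y" "hereditary F" "0 \<le> x" "x \<le> 1"
    and "2 ^ k \<le> card F" "card F \<le> 2 ^ Suc k"
  shows "(1 + x) ^ Suc k - (2 ^ Suc k - real (card F)) * (x * ((1 + x) / 2) ^ k) \<le> (\<Sum>A\<in>F. x ^ card A)"
proof -
  let ?p = "log 2 (1 + x)" 
  define a where "a = real (card F) / 2 ^ k - 1"
  note p = log_one_plus_bounds[OF assms(4,5)]
  have c: "real (card F) = 2 ^ k * (1 + a)" by (simp add: a_def)
  have "2 ^ k \<le> real (card F)" "real (card F) \<le> 2 * 2 ^ k"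
    using assms(6,7) by (metis of_nat_le_iff of_nat_numeral of_nat_power, metis of_nat_le_iff of_nat_numeral of_nat_power power_Suc)
  then have a: "0 \<le> a" "a \<le> 1" unfolding a_def by (auto simp: field_simps)
  note C = concave_on_powr[OF p(1,2), unfolded concave_on_iff, THEN conjunct2, rule_format, of 2 1 a "1 - a"]
  have "a * (1 + x) + (1 - a) \<le> (1 + a) powr ?p"
    using C a p(3) by (simp add: algebra_simps)
  then have "(a * (1 + x) + (1 - a)) * (1 + x) ^ k \<le> (1 + a) powr ?p * (1 + x) ^ k"
    using assms by (intro mult_right_mono) auto
  also have "\<dots> = real (card F) powr ?p"
    unfolding c using power_two_powr_log[OF assms(4,5), of k] a by (simp add: powr_mult)
  also have "\<dots> \<le> (\<Sum>A\<in>F. x ^ card A)" by (rule generating_function_ge[OF assms(1-5)])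
  finally have "(a * (1 + x) + (1 - a)) * (1 + x) ^ k \<le> (\<Sum>A\<in>F. x ^ card A)" .
  moreover have "(1 + x) ^ Suc k - (2 ^ Suc k - real (card F)) * (x * ((1 + x) / 2) ^ k)
      = (a * (1 + x) + (1 - a)) * (1 + x) ^ k"
    unfolding c by (simp add: power_divide field_simps)
  ultimately show ?thesis by simp
qed

text \<open>The integral of (1 + x)^k over the unit interval, which is \<open>mass 1\<close> of the
  full k-cube.\<close>

definition cube_mass :: "nat \<Rightarrow> real" where
  "cube_mass k = (2 ^ Suc k - 1) / real (Suc k)"

text \<open>This is the integral of x ((1 + x) / 2) ^ k over the unit interval, the average of
  1 / (|A| + 2) over all subsets A of a k-element set.\<close>
definition om :: "nat \<Rightarrow> real" where
  "om k = (2 * real k + (1 / 2) ^ k) / ((real k + 1) * (real k + 2))"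

section \<open>Integration over the unit interval\<close>

lemma has_integral_power_unit:
  "((\<lambda>x::real. x ^ k) has_integral 1 / real (k + 1)) {0..1}"
proof -
  have "((\<lambda>x::real. x ^ k) has_integral 1 ^ Suc k / real (Suc k) - 0 ^ Suc k / real (Suc k)) {0..1}"
    by (rule fundamental_theorem_of_calculus)
       (auto intro!: derivative_eq_intros simp: has_real_derivative_iff_has_vector_derivative[symmetric]
         simp del: power_Suc of_nat_Suc)
  then show ?thesis by simp
qed

lemma has_integral_one_plus_power:
  "((\<lambda>x::real. (1 + x) ^ k) has_integral cube_mass k) {0..1}"
proof -
  have "((\<lambda>x::real. (1 + x) ^ k) has_integral (1 + 1) ^ Suc k / real (Suc k) - (1 + 0) ^ Suc k / real (Suc k)) {0..1}"
    by (rule fundamental_theorem_of_calculus)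
       (auto intro!: derivative_eq_intros simp: has_real_derivative_iff_has_vector_derivative[symmetric]
         simp del: power_Suc of_nat_Suc)
  then show ?thesis by (simp add: cube_mass_def diff_divide_distrib)
qed

lemma has_integral_om:
  "((\<lambda>x::real. x * ((1 + x) / 2) ^ k) has_integral om k) {0..1}"
proof -
  \<comment> \<open>With y = (1 + x)/2 one has x = 2y - 1 and dx = 2 dy, so the powers of y
    integrate separately.\<close>
  let ?g = "\<lambda>x::real. 4 * ((1 + x) / 2) ^ (k + 2) / real (k + 2) - 2 * ((1 + x) / 2) ^ (k + 1) / real (k + 1)"
  have "((\<lambda>x::real. x * ((1 + x) / 2) ^ k) has_integral ?g 1 - ?g 0) {0..1}"
  proof (rule fundamental_theorem_of_calculus)
    fix x :: real assume "x \<in> {0..1}"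
    have 1: "((\<lambda>x::real. ((1 + x) / 2) ^ (k + 2)) has_real_derivative real (k + 2) * ((1 + x) / 2) ^ (k + 1) * (1 / 2)) (at x within {0..1})"
      by (auto intro!: derivative_eq_intros simp del: power_Suc of_nat_Suc)
    have 2: "((\<lambda>x::real. ((1 + x) / 2) ^ (k + 1)) has_real_derivative real (k + 1) * ((1 + x) / 2) ^ k * (1 / 2)) (at x within {0..1})"
      by (auto intro!: derivative_eq_intros simp del: power_Suc of_nat_Suc)
    have "(?g has_real_derivative 4 * (real (k + 2) * ((1 + x) / 2) ^ (k + 1) * (1 / 2)) / real (k + 2)
        - 2 * (real (k + 1) * ((1 + x) / 2) ^ k * (1 / 2)) / real (k + 1)) (at x within {0..1})"
      by (intro DERIV_diff DERIV_cdivide DERIV_cmult 1 2)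
    moreover have "4 * (real (k + 2) * ((1 + x) / 2) ^ (k + 1) * (1 / 2)) / real (k + 2)
        - 2 * (real (k + 1) * ((1 + x) / 2) ^ k * (1 / 2)) / real (k + 1) = x * ((1 + x) / 2) ^ k"
    proof -
      have g: "c * (a * y * (1 / 2)) / a = c / 2 * y" if "a \<noteq> 0" for a c y :: real using that by simp
      have "2 * ((1 + x) / 2) ^ (k + 1) - ((1 + x) / 2) ^ k = x * ((1 + x) / 2) ^ k"
        by (simp add: algebra_simps)
      then show ?thesis by (subst (1 2) g) (simp_all del: power_Suc)
    qed
    ultimately show "(?g has_vector_derivative x * ((1 + x) / 2) ^ k) (at x within {0..1})"
      by (simp add: has_real_derivative_iff_has_vector_derivative)
  qed simp
  moreover have "?g 1 - ?g 0 = om k"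
  proof -
    have "?g 1 = 4 / (real k + 2) - 2 / (real k + 1)" by (simp add: add.commute)
    moreover have "?g 0 = (1 / 2) ^ k / (real k + 2) - (1 / 2) ^ k / (real k + 1)"
      by (simp add: power_add add.commute)
    moreover have "4 / (real k + 2) - 2 / (real k + 1) - ((1 / 2) ^ k / (real k + 2) - (1 / 2) ^ k / (real k + 1)) = om k"
      unfolding om_def by (simp add: divide_simps)
    ultimately show ?thesis by simp
  qed
  ultimately show ?thesis by simp
qed

lemma has_integral_mass:
  "finite F \<Longrightarrow> ((\<lambda>x::real. \<Sum>A\<in>F. x ^ card A) has_integral mass 1 F) {0..1}"
  unfolding mass_def by (intro has_integral_sum has_integral_power_unit)

lemma has_integral_mass_Suc:
  "finite F \<Longrightarrow> ((\<lambda>x::real. x * (\<Sum>A\<in>F. x ^ card A)) has_integral mass 2 F) {0..1}"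
proof -
  assume "finite F"
  then have "((\<lambda>x::real. \<Sum>A\<in>F. x ^ (card A + 1)) has_integral (\<Sum>A\<in>F. 1 / real (card A + 1 + 1))) {0..1}"
    by (intro has_integral_sum has_integral_power_unit)
  then show ?thesis by (simp add: sum_distrib_left mass_def add.commute)
qed

lemma mass_two_ge_linear:
  assumes "finite Y" "F \<subseteq> Pow Y" "hereditary F" "card F \<le> 2 ^ k"
  shows "real (card F) * om k \<le> mass 2 F"
proof (rule has_integral_le)
  have "finite F" using assms finite_subset by blast
  then show "((\<lambda>x::real. x * (\<Sum>A\<in>F. x ^ card A)) has_integral mass 2 F) {0..1}"
    by (rule has_integral_mass_Suc)
  show "((\<lambda>x. real (card F) * (x * ((1 + x) / 2) ^ k)) has_integral real (card F) * om k) {0..1}"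
    by (intro has_integral_mult_right has_integral_om)
  fix x :: real assume "x \<in> {0..1}"
  then show "real (card F) * (x * ((1 + x) / 2) ^ k) \<le> x * (\<Sum>A\<in>F. x ^ card A)"
    using generating_function_ge_linear[OF assms(1-3) _ _ assms(4), of x]
    by (simp add: mult_left_mono mult.left_commute)
qed

lemma mass_one_ge_chord:
  assumes "finite Y" "F \<subseteq> Pow Y" "hereditary F" "2 ^ k \<le> card F" "card F \<le> 2 ^ Suc k"
  shows "cube_mass (Suc k) - (2 ^ Suc k - real (card F)) * om k \<le> mass 1 F"
proof (rule has_integral_le)
  have "finite F" using assms finite_subset by blast
  then show "((\<lambda>x::real. \<Sum>A\<in>F. x ^ card A) has_integral mass 1 F) {0..1}"
    by (rule has_integral_mass)
  show "((\<lambda>x. (1 + x) ^ Suc k - (2 ^ Suc k - real (card F)) * (x * ((1 + x) / 2) ^ k))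
      has_integral cube_mass (Suc k) - (2 ^ Suc k - real (card F)) * om k) {0..1}"
    by (intro has_integral_diff has_integral_one_plus_power has_integral_mult_right has_integral_om)
  fix x :: real assume "x \<in> {0..1}"
  then show "(1 + x) ^ Suc k - (2 ^ Suc k - real (card F)) * (x * ((1 + x) / 2) ^ k) \<le> (\<Sum>A\<in>F. x ^ card A)"
    using generating_function_ge_chord[OF assms(1-3) _ _ assms(4,5), of x] by simp
qed

text \<open>The extra factor x turns the slope into \<open>x * (x * ((1 + x) / 2) ^ k)\<close>;
  writing one x as twice (1 + x)/2 minus 1 expresses its integral through \<open>om\<close>.\<close>

lemma mass_two_ge_chord:
  assumes "finite Y" "F \<subseteq> Pow Y" "hereditary F" "2 ^ k \<le> card F" "card F \<le> 2 ^ Suc k"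
  shows "2 ^ Suc k * om (Suc k) - (2 ^ Suc k - real (card F)) * (2 * om (Suc k) - om k) \<le> mass 2 F"
proof (rule has_integral_le)
  let ?c = "2 ^ Suc k - real (card F)"
  have "finite F" using assms finite_subset by blast
  then show "((\<lambda>x::real. x * (\<Sum>A\<in>F. x ^ card A)) has_integral mass 2 F) {0..1}"
    by (rule has_integral_mass_Suc)
  show "((\<lambda>x. 2 ^ Suc k * (x * ((1 + x) / 2) ^ Suc k)
        - ?c * (2 * (x * ((1 + x) / 2) ^ Suc k) - (x * ((1 + x) / 2) ^ k)))
      has_integral 2 ^ Suc k * om (Suc k) - ?c * (2 * om (Suc k) - om k)) {0..1}"
    by (intro has_integral_diff has_integral_mult_right has_integral_om)
  fix x :: real assume x: "x \<in> {0..1}"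
  have "x * ((1 + x) ^ Suc k - ?c * (x * ((1 + x) / 2) ^ k)) \<le> x * (\<Sum>A\<in>F. x ^ card A)"
    using generating_function_ge_chord[OF assms(1-3) _ _ assms(4,5), of x] x by (intro mult_left_mono) auto
  moreover have "2 ^ Suc k * (x * ((1 + x) / 2) ^ Suc k) = x * (1 + x) ^ Suc k"
    by (simp add: power_divide)
  moreover have "2 * (x * ((1 + x) / 2) ^ Suc k) - (x * ((1 + x) / 2) ^ k) = x * (x * ((1 + x) / 2) ^ k)"
    by (simp add: algebra_simps)
  ultimately show "2 ^ Suc k * (x * ((1 + x) / 2) ^ Suc k)
        - ?c * (2 * (x * ((1 + x) / 2) ^ Suc k) - (x * ((1 + x) / 2) ^ k)) \<le> x * (\<Sum>A\<in>F. x ^ card A)"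
    by (simp only: right_diff_distrib mult.assoc mult.left_commute)
qed

text \<open>Both sides of the linear bound on the generating function agree at 1, so comparing their
  derivatives there bounds the sum of the cardinalities.\<close>
lemma sum_card_le:
  assumes "finite Y" "F \<subseteq> Pow Y" "hereditary F" "card F \<le> 2 ^ N"
  shows "2 * (\<Sum>A\<in>F. card A) \<le> card F * N"
proof (rule ccontr)
  assume neg: "\<not> ?thesis"
  let ?f = "\<lambda>x::real. (\<Sum>A\<in>F. x ^ card A) - real (card F) * ((1 + x) / 2) ^ N"
  have "(?f has_real_derivative (\<Sum>A\<in>F. real (card A)) - real (card F) * (real N * (1 / 2))) (at 1)"
    by (auto intro!: derivative_eq_intros)
  moreover have "(\<Sum>A\<in>F. real (card A)) - real (card F) * (real N * (1 / 2)) > 0"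
  proof -
    have "real (card F * N) < real (2 * (\<Sum>A\<in>F. card A))" using neg by linarith
    then show ?thesis by simp
  qed
  ultimately obtain d where d: "d > 0" "\<forall>h>0. h < d \<longrightarrow> ?f (1 - h) < ?f 1"
    using DERIV_pos_inc_left[of ?f _ 1] by blast
  define h where "h = min (d / 2) 1"
  have h: "0 < h" "h < d" "h \<le> 1" using d(1) by (auto simp: h_def)
  have "?f (1 - h) < ?f 1" using d h by blast
  moreover have "?f 1 = 0" by simp
  moreover have "?f (1 - h) \<ge> 0"
    using generating_function_ge_linear[OF assms(1-3) _ _ assms(4), of "1 - h"] h by simp
  ultimately show False by linarith
qed

section \<open>Estimates for \<open>om\<close>\<close>

lemma om_le: "om k \<le> 2 / real (k + 2)"
proof -
  have "(1 / 2 :: real) ^ k \<le> 1" by (simp add: power_le_one)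
  then have "om k \<le> (2 * (real k + 1)) / ((real k + 1) * (real k + 2))"
    unfolding om_def by (intro divide_right_mono) auto
  also have "\<dots> = 2 / real (k + 2)" by (simp add: divide_simps) (simp add: algebra_simps)
  finally show ?thesis .
qed

lemma om_ge: "2 * real k / ((real k + 1) * (real k + 2)) \<le> om k"
  unfolding om_def by (intro divide_right_mono) auto

text \<open>The left side is the exact difference of the rational parts 2k/((k+1)(k+2)); the powers
  of 1/2 contribute a nonnegative remainder.\<close>

lemma om_diff_ge:
  "2 * (real k - 1) / ((real k + 1) * (real k + 2) * (real k + 3)) \<le> om k - om (Suc k)"
proof -
  let ?p = "(1 / 2 :: real) ^ k"
  have "om k - om (Suc k) - 2 * (real k - 1) / ((real k + 1) * (real k + 2) * (real k + 3))
     = ?p * (1 / ((real k + 1) * (real k + 2)) - 1 / (2 * ((real k + 2) * (real k + 3))))"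
    unfolding om_def by (simp add: divide_simps) (simp add: algebra_simps)
  moreover have "1 / (2 * ((real k + 2) * (real k + 3))) \<le> 1 / ((real k + 1) * (real k + 2))"
  proof (rule divide_left_mono)
    show "(real k + 1) * (real k + 2) \<le> 2 * ((real k + 2) * (real k + 3))"
      by (simp add: algebra_simps)
  qed auto
  ultimately show ?thesis
    by (smt (verit, best) mult_nonneg_nonneg zero_le_power divide_nonneg_nonneg)
qed

lemma om_Suc_le: "om (Suc k) \<le> om k"
proof (cases k)
  case 0
  then show ?thesis by (simp add: om_def)
next
  case (Suc j)
  have "0 \<le> 2 * (real k - 1) / ((real k + 1) * (real k + 2) * (real k + 3))"
    using Suc by simp
  then show ?thesis using om_diff_ge[of k] by linarith
qed

lemma om_antimono: "i \<le> j \<Longrightarrow> om j \<le> om i"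
  by (rule lift_Suc_antimono_le[of om]) (rule om_Suc_le)

section \<open>Hereditary families with large support\<close>

definition supp :: "'a set set \<Rightarrow> 'a set" where
  "supp F = {x. {x} \<in> F}"

lemma subset_Pow_supp: "hereditary F \<Longrightarrow> F \<subseteq> Pow (supp F)"
  unfolding hereditary_def supp_def by blast

lemma finite_if_finite_supp: "hereditary F \<Longrightarrow> finite (supp F) \<Longrightarrow> finite F"
  by (meson finite_Pow_iff finite_subset subset_Pow_supp)

lemma supp_del: "supp (del F x) = supp F - {x}"
  unfolding supp_def del_def by auto

lemma hereditary_Diff_maximal:
  assumes "hereditary F" "hereditary K" "A \<in> F" "\<And>B. B \<in> F - K \<Longrightarrow> A \<subseteq> B \<Longrightarrow> B = A" "A \<notin> K"
  shows "hereditary (F - {A})"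
  unfolding hereditary_def
proof (intro ballI allI impI)
  fix B C assume B: "B \<in> F - {A}" "C \<subseteq> B"
  have "C \<noteq> A"
  proof
    assume "C = A"
    then have "B \<notin> K" using assms(2,5) B hereditaryD by blast
    then show False using assms(4)[of B] B \<open>C = A\<close> by auto
  qed
  then show "C \<in> F - {A}" using B assms(1) hereditaryD by blast
qed

text \<open>Deleting maximal members of \<open>F - K\<close> one at a time keeps the family
  hereditary and reaches every intermediate size.\<close>

lemma hereditary_between:
  assumes "hereditary K" "K \<subseteq> F" "card K \<le> m" "m \<le> card F" "hereditary F" "finite F"
  shows "\<exists>G. hereditary G \<and> K \<subseteq> G \<and> G \<subseteq> F \<and> card G = m"
  using assms
proof (induction "card F - m" arbitrary: F)
  case 0
  then show ?case by (intro exI[of _ F]) auto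
next
  case (Suc n)
  have "F - K \<noteq> {}"
    using Suc.hyps(2) Suc.prems by (metis Diff_eq_empty_iff card_mono diff_is_0_eq finite_subset le_trans nat.simps(3))
  then obtain A where A: "A \<in> F - K" "\<And>B. B \<in> F - K \<Longrightarrow> A \<subseteq> B \<Longrightarrow> A = B"
    using finite_has_maximal[of "F - K"] Suc.prems by (metis finite_Diff)
  have h: "hereditary (F - {A})"
    using A Suc.prems by (intro hereditary_Diff_maximal[of F K A]) auto
  have c: "card (F - {A}) = card F - 1" using A Suc.prems by simp
  have "\<exists>G. hereditary G \<and> K \<subseteq> G \<and> G \<subseteq> F - {A} \<and> card G = m"
    using Suc.hyps(2) Suc.prems A c by (intro Suc.hyps(1) h) auto
  then show ?case by blast
qed

text \<open>Averaging: the degrees sum to the sum of the cardinalities, at most half of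
  \<open>card F * N\<close> by \<open>sum_card_le\<close>, spread over at least N + 1 points. A full
  N-cube has only N points, so a spare point pushes some degree below half of the family by a
  definite factor.\<close>

lemma exists_low_degree:
  assumes "hereditary F" "finite (supp F)" "card F \<le> 2 ^ N" "N + 1 \<le> card (supp F)"
  shows "\<exists>z\<in>supp F. 2 * (N + 1) * card (link F z) \<le> card F * N"
proof (rule ccontr)
  assume neg: "\<not> ?thesis"
  have fF: "finite F" using assms finite_if_finite_supp by blast
  have ne: "supp F \<noteq> {}" using assms(4) by auto
  have "(N + 1) * (card F * N) \<le> card (supp F) * (card F * N)"
    using assms(4) by (rule mult_right_mono) simp
  also have "\<dots> = (\<Sum>z\<in>supp F. card F * N)" by simp
  also have "\<dots> < (\<Sum>z\<in>supp F. 2 * (N + 1) * card (link F z))"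
    using neg assms(2) ne by (intro sum_strict_mono) (auto simp: not_le)
  also have "\<dots> = 2 * (N + 1) * (\<Sum>z\<in>supp F. card {A \<in> F. z \<in> A})"
    by (simp only: sum_distrib_left card_link)
  also have "(\<Sum>z\<in>supp F. card {A \<in> F. z \<in> A}) = (\<Sum>A\<in>F. card {z \<in> supp F. z \<in> A})"
    using sum.swap_restrict[OF assms(2) fF, of "\<lambda>_ _. 1::nat" "\<lambda>z A. z \<in> A"] by simp
  also have "\<dots> = (\<Sum>A\<in>F. card A)"
    using subset_Pow_supp[OF assms(1)] by (intro sum.cong refl arg_cong[of _ _ card]) auto
  also have "2 * (N + 1) * (\<Sum>A\<in>F. card A) \<le> (N + 1) * (card F * N)"
    using sum_card_le[OF assms(2) subset_Pow_supp[OF assms(1)] assms(1,3)]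
    by (simp only: mult.assoc mult.left_commute[of 2]) (simp del: mult_Suc add: mult_left_mono)
  finally show False by simp
qed

section \<open>Numerical estimates for powers of two\<close>

lemma two_power_ge:
  assumes "49 \<le> N"
  shows "16 * (N + 1) ^ 4 \<le> (2::nat) ^ N"
  using assms
proof (induction N rule: dec_induct)
  case base
  then show ?case by simp
next
  case (step n)
  have "(n + 2) ^ 4 \<le> 2 * (n + 1) ^ 4"
  proof -
    \<comment> \<open>7/5 lies slightly below the square root of 2, so squaring gives the ratio
      49/25 < 2.\<close>
    have "(n + 2) ^ 2 * 5 \<le> (n + 1) ^ 2 * 7"
    proof -
      have "49 * n \<le> n * n" using step by (intro mult_right_mono) auto
      then have "13 + n * 6 \<le> n * (n * 2)" using step by linarith
      then show ?thesis by (simp add: power2_eq_square algebra_simps)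
    qed
    then have "((n + 2) ^ 2 * 5) ^ 2 \<le> ((n + 1) ^ 2 * 7) ^ 2" by (rule power_mono) simp
    then have "25 * (n + 2) ^ 4 \<le> 49 * (n + 1) ^ 4"
      by (simp add: power_mult_distrib power_mult[symmetric])
    then show ?thesis by linarith
  qed
  then show ?case using step.IH by simp
qed

text \<open>Used with \<open>2 ^ k\<close> bounded by a number of missing sets: the codimension of a
  missing set is then at most an eighth of the dimension. Up to k = 6 the bound 48 <= N + 1
  suffices; from k = 7 on, 56 <= 64 starts an induction.\<close>

lemma small_power_of_two_exponent:
  assumes "49 \<le> N" "(2::nat) ^ k \<le> 2 * (N + 1)"
  shows "8 * k \<le> N + 1"
proof (cases "k \<le> 6")
  case True
  then show ?thesis using assms by linarith
next
  case False
  have "8 * k \<le> 2 ^ (k - 1)" if "7 \<le> k" for k :: nat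
    using that
  proof (induction k rule: dec_induct)
    case (step n)
    then obtain j where "n = Suc j" by (cases n) auto
    then show ?case using step by simp
  qed simp
  then have "8 * k \<le> 2 ^ (k - 1)" using False by simp
  then have "2 * (8 * k) \<le> 2 * 2 ^ (k - 1)" by (rule mult_left_mono) simp
  also have "\<dots> = 2 ^ k" using False by (cases k) auto
  also have "\<dots> \<le> 2 * (N + 1)" by (rule assms(2))
  finally show ?thesis by simp
qed

text \<open>The gain in \<open>mass_gain\<close> from a point whose degree lies between
  \<open>2 ^ (k - 1)\<close> and \<open>2 ^ k\<close>. The case k = 3 only just works: 4 * (3/10 -
  1/25) = 1.04.\<close>

lemma half_power_om_diff_ge:
  assumes "49 \<le> N" "3 \<le> k" "k \<le> N - 2"
  shows "1 \<le> 2 ^ (k - 1) * (om k - om (N - 1))"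
proof (cases "k \<le> 6")
  case True
  have "om (N - 1) \<le> 2 / real (N - 1 + 2)" by (rule om_le)
  also have "\<dots> \<le> 1 / 25" using assms by (simp add: field_simps)
  finally have 1: "om (N - 1) \<le> 1 / 25" .
  from True assms consider "k = 3" | "k = 4" | "k = 5" | "k = 6" by linarith
  then show ?thesis using 1 om_ge[of k] by cases auto
next
  case False
  \<comment> \<open>The induction can only start at 7, where 720 <= 768; k = 6 would give 504 > 320,
    hence the separate small cases above.\<close>
  have p: "(k + 1) * (k + 2) * (k + 3) \<le> 2 ^ k * (k - 1)" if "7 \<le> k" for k :: nat
    using that
  proof (induction k rule: dec_induct)
    case base
    then show ?case by simp
  next
    case (step n)
    have "(Suc n + 1) * (Suc n + 2) * (Suc n + 3) = (n + 4) * ((n + 2) * (n + 3))" by (simp add: algebra_simps)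
    also have "\<dots> \<le> (2 * (n + 1)) * ((n + 2) * (n + 3))" using step by (intro mult_right_mono) auto
    also have "\<dots> = 2 * ((n + 1) * (n + 2) * (n + 3))" by (simp only: mult.assoc)
    also have "\<dots> \<le> 2 * (2 ^ n * (n - 1))" using step by simp
    also have "\<dots> \<le> 2 ^ Suc n * (Suc n - 1)" by simp
    finally show ?case .
  qed
  have "1 \<le> 2 ^ (k - 1) * (2 * (real k - 1) / ((real k + 1) * (real k + 2) * (real k + 3)))"
  proof -
    have "real ((k + 1) * (k + 2) * (k + 3)) \<le> real (2 ^ k * (k - 1))"
      using p[of k] False by (simp only: of_nat_le_iff)
    moreover have "real ((k + 1) * (k + 2) * (k + 3)) = (real k + 1) * (real k + 2) * (real k + 3)"
      by (simp only: of_nat_mult of_nat_add of_nat_1 of_nat_numeral)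
    moreover have "real (2 ^ k * (k - 1)) = 2 ^ k * (real k - 1)" using False by (simp add: of_nat_diff)
    ultimately have "(real k + 1) * (real k + 2) * (real k + 3) \<le> 2 ^ k * (real k - 1)" by (simp only:)
    moreover have "(2::real) ^ k = 2 ^ (k - 1) * 2" using False by (cases k) auto
    ultimately show ?thesis by (simp add: le_divide_eq mult.assoc)
  qed
  also have "\<dots> \<le> 2 ^ (k - 1) * (om k - om (Suc k))"
    using om_diff_ge[of k] by (intro mult_left_mono) auto
  also have "\<dots> \<le> 2 ^ (k - 1) * (om k - om (N - 1))"
    using om_antimono[of "Suc k" "N - 1"] assms by (intro mult_left_mono) auto
  finally show ?thesis .
qed

lemma power_of_two_bracket:
  assumes "4 \<le> (t::nat)" "t \<le> 2 ^ n" "3 \<le> n"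
  shows "\<exists>k\<ge>3. k \<le> n \<and> 2 ^ (k - 1) \<le> t \<and> t \<le> 2 ^ k"
proof (cases "t \<le> 8")
  case True
  then show ?thesis using assms by (intro exI[of _ 3]) auto
next
  case False
  define k where "k = (LEAST k. t \<le> 2 ^ k)"
  have k: "t \<le> 2 ^ k" "k \<le> n" unfolding k_def using assms(2) by (auto intro: LeastI Least_le)
  have "3 \<le> k"
  proof (rule ccontr)
    assume "\<not> 3 \<le> k"
    then have "(2::nat) ^ k \<le> 2 ^ 3" by (intro power_increasing) auto
    then show False using k False by simp
  qed
  moreover have "\<not> t \<le> 2 ^ (k - 1)"
    using not_less_Least[of "k - 1" "\<lambda>k. t \<le> 2 ^ k"] \<open>3 \<le> k\<close> unfolding k_def by auto
  ultimately show ?thesis using k by (intro exI[of _ k]) auto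
qed

text \<open>The linear bound for a cube loses up to 1 more than the final bound allows. Removing one
  point of degree at least 4 makes up for this; for smaller degrees up to three points have to be
  removed in turn.\<close>
lemma mass_gain:
  assumes N: "49 \<le> N" and F: "hereditary F" "finite (supp F)"
    and c: "card F + q = 2 ^ N" "q \<le> N + 3" and s: "N + 1 \<le> card (supp F)"
  shows "\<exists>z\<in>supp F. 1 \<le> card (link F z) \<and>
    cube_mass N - 2 * real q / (real N + 1)
      + (if card (link F z) = 1 then 23 / 50 else if card (link F z) \<le> 3 then 3 / 4 else 1) \<le> mass 1 F"
proof -
  obtain z where z: "z \<in> supp F" "2 * (N + 1) * card (link F z) \<le> card F * N"
    using exists_low_degree[OF F _ s] c by auto
  define t where "t = card (link F z)"
  define w where "w = om (N - 1)"
  obtain M where M: "N = Suc (Suc M)" using N by (metis Suc_le_D numeral_eq_Suc Suc_le_D le_trans not_less_eq_eq pred_numeral_simps)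
  have fF: "finite F" using F finite_if_finite_supp by blast
  have Y: "F \<subseteq> Pow (supp F)" using subset_Pow_supp[OF F(1)] .
  have t1: "1 \<le> t"
  proof -
    have "{} \<in> link F z" using z(1) by (simp add: link_def supp_def)
    then show ?thesis unfolding t_def using finite_link[OF fF] by (simp add: Suc_le_eq card_gt_0_iff) blast
  qed
  have cd: "card F = card (del F z) + t" using card_del_link[OF fF] t_def by simp
  have big: "(N + 2) * (N + 3) \<le> 2 ^ N"
  proof -
    have "(N + 2) * (N + 3) \<le> 16 * ((N + 1) * (N + 1) * ((N + 1) * (N + 1)))"
    proof -
      have "(N + 2) * (N + 3) \<le> 4 * (N + 1) * (4 * (N + 1))" by (intro mult_mono) auto
      also have "\<dots> = 16 * ((N + 1) * (N + 1) * 1)" by (simp add: algebra_simps)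
      also have "\<dots> \<le> 16 * ((N + 1) * (N + 1) * ((N + 1) * (N + 1)))" by (intro mult_left_mono) auto
      finally show ?thesis .
    qed
    then show ?thesis using two_power_ge[OF N] unfolding power4_eq_xxxx mult.assoc by (rule order_trans)
  qed
  \<comment> \<open>The low degree of z leaves at least half of a cube, so the chord between
    \<open>2 ^ (N - 1)\<close> and \<open>2 ^ N\<close> applies to \<open>del F z\<close>; the few
    missing sets are absorbed by the factor (N + 2)/(N + 1).\<close>
  have a1: "2 ^ (N - 1) \<le> card (del F z)"
  proof -
    have "(N + 2) * q \<le> (N + 2) * (N + 3)" using c by (intro mult_left_mono) auto
    then have "(N + 2) * q \<le> 2 ^ N" using big by linarith
    then have 1: "(N + 1) * 2 ^ N \<le> (N + 2) * card F" unfolding c(1)[symmetric] by (simp add: algebra_simps)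
    have 2: "2 * (N + 1) * card (del F z) + 2 * (N + 1) * t = 2 * (N + 1) * card F"
      unfolding cd by (simp only: distrib_left)
    have 3: "2 * (N + 1) * card F = (N + 2) * card F + card F * N" by (simp add: algebra_simps)
    have 4: "2 * (N + 1) * t \<le> card F * N" using z(2) t_def by simp
    have chain: "a \<le> x" if "a \<le> p" "x + y = m" "m = p + r" "y \<le> r" for a p x y m r :: nat
      using that by linarith
    have "(N + 1) * 2 ^ N \<le> 2 * (N + 1) * card (del F z)" by (rule chain[OF 1 2 3 4])
    then have "(N + 1) * 2 ^ N \<le> (N + 1) * (2 * card (del F z))" by (simp only: mult.assoc mult.left_commute)
    then have "2 ^ N \<le> 2 * card (del F z)" by (subst (asm) mult_le_cancel1) auto
    then show ?thesis unfolding M by simp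
  qed
  have a2: "card (del F z) \<le> 2 ^ N" using cd c(1) by linarith
  have sN: "Suc (N - 1) = N" and N3: "3 \<le> N - 2" using N by simp_all
  have "real (card (del F z)) + real t + real q = 2 ^ N"
    using c(1) cd by (metis of_nat_add of_nat_numeral of_nat_power)
  then have rd: "2 ^ N - real (card (del F z)) = real q + real t" by simp
  have D: "cube_mass N - (real q + real t) * w \<le> mass 1 (del F z)"
    using mass_one_ge_chord[of "supp F - {z}" "del F z" "N - 1", OF _ del_subset_Pow[OF Y] hereditary_del[OF F(1)] a1]
      a2 F(2) unfolding sN rd w_def by simp
  have mF: "mass 1 F = mass 1 (del F z) + mass 2 (link F z)"
    using mass_del_link[OF F(2) Y, of 1 z] by (simp add: numeral_2_eq_2)
  have L: "real t * om k \<le> mass 2 (link F z)" if "t \<le> 2 ^ k" for k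
    using mass_two_ge_linear[of "supp F - {z}" "link F z" k, OF _ link_subset_Pow[OF Y] hereditary_link[OF F(1)]]
      F(2) that unfolding t_def by simp
  have w: "w \<le> 2 / (real N + 1)" "w \<le> 1 / 25"
  proof -
    have "w \<le> 2 / real (N - 1 + 2)" unfolding w_def by (rule om_le)
    also have "N - 1 + 2 = N + 1" using N by simp
    finally show 1: "w \<le> 2 / (real N + 1)" by (simp add: add.commute)
    also have "\<dots> \<le> 1 / 25" using N by (simp add: field_simps)
    finally show "w \<le> 1 / 25" .
  qed
  have qw: "real q * w \<le> 2 * real q / (real N + 1)"
    using mult_left_mono[OF w(1), of "real q"] by (simp add: mult.commute)
  \<comment> \<open>The chord on \<open>del F z\<close> charges w for each of the t sets through z,
    while the link returns \<open>om k\<close> for each, a gain of \<open>t * (om k - w)\<close>.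
    With w <= 1/25 this is 1/2 - 1/25 = 23/50 for t = 1, while 2 * (5/12 - 1/25) and 3 * (17/48 -
    1/25) both exceed 3/4.\<close>
  define g where "g = (if t = 1 then 23 / 50 else if t \<le> 3 then 3 / 4 else (1::real))"
  have "cube_mass N - real q * w + g \<le> mass 1 F"
  proof (cases "t \<le> 2 ^ (N - 2)")
    case True
    have "\<exists>k. t \<le> 2 ^ k \<and> g \<le> real t * (om k - w)"
    proof -
      consider "t = 1" | "t = 2" | "t = 3" | "4 \<le> t" using t1 by linarith
      then show ?thesis
      proof cases
        case 1
        then show ?thesis using w by (intro exI[of _ 0]) (simp add: g_def om_def)
      next
        case 2
        then show ?thesis using w by (intro exI[of _ 1]) (simp add: g_def om_def)
      next
        case 3
        then show ?thesis using w by (intro exI[of _ 2]) (simp add: g_def om_def power2_eq_square)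
      next
        case 4
        then obtain k where k: "3 \<le> k" "k \<le> N - 2" "2 ^ (k - 1) \<le> t" "t \<le> 2 ^ k"
          using power_of_two_bracket[OF 4 True N3] by blast
        have p: "1 \<le> 2 ^ (k - 1) * (om k - w)"
          unfolding w_def by (rule half_power_om_diff_ge[OF N k(1,2)])
        have "0 \<le> om k - w" unfolding w_def using om_antimono[of k "N - 1"] k by simp
        moreover have "2 ^ (k - 1) \<le> real t" using k(3) by (metis of_nat_le_iff of_nat_numeral of_nat_power)
        ultimately have "2 ^ (k - 1) * (om k - w) \<le> real t * (om k - w)" by (rule mult_right_mono[rotated])
        then show ?thesis using p 4 k by (intro exI[of _ k]) (simp add: g_def)
      qed
    qed
    then obtain k where "t \<le> 2 ^ k" "g \<le> real t * (om k - w)" by blast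
    then show ?thesis using L[of k] D mF by (simp add: algebra_simps)
  next
    case False
    \<comment> \<open>For a link with more than \<open>2 ^ (N - 2)\<close> members the linear bound
      has no smaller k to gain from. The chord for the link gains
      \<open>h * (om (N - 2) - w)\<close> instead, and the low degree of z makes the shortfall h at
      least 2^(N-1)/(N+1).\<close>
    define h where "h = 2 ^ (N - 1) - real t"
    have tN: "2 * (N + 1) * t \<le> 2 ^ N * N"
    proof -
      have "card F * N \<le> 2 ^ N * N" using c by (intro mult_right_mono) auto
      then show ?thesis using z(2) unfolding t_def by (rule le_trans[rotated])
    qed
    have p2: "(2::real) ^ N = 2 * 2 ^ (N - 1)" "(2::nat) ^ N = 2 * 2 ^ (N - 1)" unfolding M by auto
    have "real (2 * (N + 1) * t) \<le> real (2 ^ N * N)" using tN by (simp only: of_nat_le_iff)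
    then have hh: "2 ^ (N - 1) \<le> (real N + 1) * h" unfolding h_def using p2 by (simp add: algebra_simps)
    have "t \<le> 2 ^ (N - 1)"
    proof -
      have "0 < (real N + 1) * h" using hh by (smt (verit) zero_less_power)
      then have "0 < h" by (simp add: zero_less_mult_iff)
      then have "real t \<le> real (2 ^ (N - 1))" unfolding h_def by simp
      then show ?thesis by (simp only: of_nat_le_iff)
    qed
    moreover have sM: "Suc (N - 2) = N - 1" using N by simp
    ultimately have L2: "2 ^ (N - 1) * w - h * (2 * w - om (N - 2)) \<le> mass 2 (link F z)"
      using mass_two_ge_chord[of "supp F - {z}" "link F z" "N - 2", OF _ link_subset_Pow[OF Y] hereditary_link[OF F(1)]]
        False F(2) unfolding t_def[symmetric] sM w_def h_def by simp
    have "1 \<le> h * (om (N - 2) - w)"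
    proof -
      have o: "2 * (real M - 1) / ((real M + 1) * (real M + 2) * (real M + 3)) \<le> om (N - 2) - w"
        using om_diff_ge[of M] unfolding w_def M by simp
      have rM: "real M \<ge> 47" using N M by simp
      \<comment> \<open>Of the four factors N + 1 = M + 3, one is spent on the denominator in the
        bound for h and three on the cubic denominator of \<open>om_diff_ge\<close>.\<close>
      have "16 * (real M + 3) ^ 4 \<le> 2 ^ N"
      proof -
        have "real (16 * (N + 1) ^ 4) \<le> real (2 ^ N)" using two_power_ge[OF N] by (simp only: of_nat_le_iff)
        then show ?thesis unfolding M by (simp add: algebra_simps)
      qed
      then have P: "8 * (real M + 3) ^ 4 \<le> 2 ^ (N - 1)" using p2 by simp
      have h3: "8 * (real M + 3) ^ 3 \<le> h"
      proof -
        have "(real M + 3) * (8 * (real M + 3) ^ 3) \<le> (real M + 3) * h"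
          using P hh unfolding M by (simp add: power4_eq_xxxx power3_eq_cube algebra_simps)
        then show ?thesis using rM by (subst (asm) mult_le_cancel_left) auto
      qed
      have "(real M + 1) * (real M + 2) * (real M + 3) \<le> (real M + 3) ^ 3"
        using rM unfolding power3_eq_cube by (intro mult_mono) auto
      then have d: "(real M + 1) * (real M + 2) * (real M + 3) \<le> h" using h3 rM
        by (smt (verit) zero_le_power)
      have "1 \<le> h / ((real M + 1) * (real M + 2) * (real M + 3))"
        using d rM by (subst le_divide_eq_1_pos) auto
      also have "\<dots> \<le> h * (2 * (real M - 1) / ((real M + 1) * (real M + 2) * (real M + 3)))"
      proof -
        have "0 \<le> h" using d rM by (smt (verit) mult_nonneg_nonneg)
        then have "h * 1 \<le> h * (2 * (real M - 1))" using rM by (intro mult_left_mono) auto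
        then show ?thesis using rM by (simp add: divide_right_mono)
      qed
      also have "\<dots> \<le> h * (om (N - 2) - w)"
        using o d rM by (intro mult_left_mono) (auto intro: order_trans[rotated])
      finally show ?thesis .
    qed
    moreover have "g \<le> 1" by (simp add: g_def)
    moreover have "(real q + real t) * w = real q * w + (2 ^ (N - 1) - h) * w" by (simp add: h_def algebra_simps)
    ultimately show ?thesis using D L2 mF by (simp add: algebra_simps)
  qed
  then have "cube_mass N - 2 * real q / (real N + 1) + g \<le> mass 1 F" using qw by linarith
  then show ?thesis using z(1) t1 unfolding g_def t_def by blast
qed

section \<open>Families close to a full cube, and deletion of low-degree points\<close>

lemma mass_Pow_ge:
  assumes "finite S" "card S = Suc k"
  shows "cube_mass (Suc k) \<le> mass 1 (Pow S)"
  using mass_one_ge_chord[of S "Pow S" k] assms by (auto simp: card_Pow hereditary_def)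

text \<open>The sets between A and S form a cube whose dimension is the codimension of A. Hence few
  missing sets force each of them to be large.\<close>

lemma two_power_codim_le:
  assumes "finite S" "A \<subseteq> S" "\<And>C. C \<subseteq> S \<Longrightarrow> A \<subseteq> C \<Longrightarrow> C \<in> M" "finite M"
  shows "2 ^ (card S - card A) \<le> card M"
proof -
  have "inj_on (\<lambda>C. A \<union> C) (Pow (S - A))"
    by (rule inj_onI) blast
  then have "card ((\<lambda>C. A \<union> C) ` Pow (S - A)) = 2 ^ (card S - card A)"
    using assms by (simp add: card_image card_Pow card_Diff_subset finite_subset)
  moreover have "(\<lambda>C. A \<union> C) ` Pow (S - A) \<subseteq> M"
  proof
    fix C assume "C \<in> (\<lambda>C. A \<union> C) ` Pow (S - A)"
    then have "C \<subseteq> S" "A \<subseteq> C" using assms(2) by auto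
    then show "C \<in> M" by (rule assms(3))
  qed
  then have "card ((\<lambda>C. A \<union> C) ` Pow (S - A)) \<le> card M" by (rule card_mono[OF assms(4)])
  ultimately show ?thesis by simp
qed

text \<open>Count what is missing from the cube on the support. A missing set has codimension at
  most (N + 1)/8, so it weighs at most 8/7 of 1/(N + 1); the excess is one seventh of q/(N + 1) <=
  21/20, which is at most 3/20.\<close>

lemma mass_ge_near_cube:
  assumes N: "49 \<le> N" and F: "hereditary F" "finite (supp F)"
    and c: "card F + q = 2 ^ N" "q \<le> N + 3" and s: "card (supp F) = N"
  shows "cube_mass N - real q / (real N + 1) - 3 / 20 \<le> mass 1 F"
proof -
  let ?S = "supp F"
  define M where "M = Pow ?S - F"
  have fF: "finite F" using F finite_if_finite_supp by blast
  have FS: "F \<subseteq> Pow ?S" using subset_Pow_supp[OF F(1)] .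
  have fM: "finite M" unfolding M_def using F(2) by simp
  have cM: "card M = q" unfolding M_def using c s F(2) FS fF by (simp add: card_Diff_subset card_Pow)
  have "mass 1 (Pow ?S) = mass 1 F + mass 1 M"
    unfolding mass_def M_def using FS F(2) by (simp add: sum.subset_diff[of F "Pow ?S"])
  moreover have "cube_mass N \<le> mass 1 (Pow ?S)"
    using mass_Pow_ge[of ?S "N - 1"] F(2) s N by simp
  moreover have "mass 1 M \<le> real q / (real N + 1) + 3 / 20"
  proof -
    have el: "1 / real (card A + 1) \<le> 8 / (7 * (real N + 1))" if A: "A \<in> M" for A
    proof -
      have AS: "A \<subseteq> ?S" "A \<notin> F" using A M_def by auto
      have "2 ^ (card ?S - card A) \<le> card M"
        using AS F(1) by (intro two_power_codim_le F(2) fM) (auto simp: M_def dest: hereditaryD)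
      also have "card M \<le> 2 * (N + 1)" using cM c(2) N by simp
      finally have "2 ^ (N - card A) \<le> 2 * (N + 1)" unfolding s .
      then have "8 * (N - card A) \<le> N + 1" using small_power_of_two_exponent[OF N] by blast
      then have "7 * (N + 1) \<le> 8 * (card A + 1)" by arith
      then have "real (7 * (N + 1)) \<le> real (8 * (card A + 1))" by (simp only: of_nat_le_iff)
      then show ?thesis by (simp add: field_simps)
    qed
    have "mass 1 M \<le> real (card M) * (8 / (7 * (real N + 1)))"
      unfolding mass_def using sum_bounded_above[of M, OF el] by simp
    also have "\<dots> = 8 / 7 * (real q / (real N + 1))" unfolding cM by simp
    finally have "mass 1 M \<le> 8 / 7 * (real q / (real N + 1))" .
    moreover have "real q / (real N + 1) \<le> 21 / 20" using c(2) N by (simp add: field_simps)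
    ultimately show ?thesis by linarith
  qed
  ultimately show ?thesis by linarith
qed

lemma mass_link_ge:
  assumes "hereditary F" "finite (supp F)" "card (link F z) \<le> 2 ^ k"
  shows "mass 1 (del F z) + real (card (link F z)) * om k \<le> mass 1 F"
proof -
  note Y = subset_Pow_supp[OF assms(1)]
  have "real (card (link F z)) * om k \<le> mass 2 (link F z)"
    using mass_two_ge_linear[OF _ link_subset_Pow[OF Y] hereditary_link[OF assms(1)] assms(3)] assms(2) by blast
  moreover have "mass 1 F = mass 1 (del F z) + mass 2 (link F z)"
    using mass_del_link[OF assms(2) Y, of 1 z] by (simp add: numeral_2_eq_2)
  ultimately show ?thesis by linarith
qed

lemma card_del_add:
  "hereditary F \<Longrightarrow> finite (supp F) \<Longrightarrow> card F + q = m \<Longrightarrow> card (del F z) + (q + card (link F z)) = m"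
  using card_del_link[OF finite_if_finite_supp, of F z] by simp

text \<open>The weakest gain 23/50 is set against the surplus charge q/(N + 1) <= 26/25, and 26/25 -
  23/50 = 29/50. The range q <= N + 3 leaves room for deleting a point of degree up to 3 in
  \<open>mass_ge_exact\<close>.\<close>

lemma mass_ge_loss_29_50:
  assumes N: "49 \<le> N" and F: "hereditary F" "finite (supp F)"
    and c: "card F + q = 2 ^ N" "q \<le> N + 3" and s: "N \<le> card (supp F)"
  shows "cube_mass N - real q / (real N + 1) - 29 / 50 \<le> mass 1 F"
proof (cases "card (supp F) = N")
  case True
  then show ?thesis using mass_ge_near_cube[OF N F c] by linarith
next
  case False
  then obtain z where "cube_mass N - 2 * real q / (real N + 1)
      + (if card (link F z) = 1 then 23 / 50 else if card (link F z) \<le> 3 then 3 / 4 else 1) \<le> mass 1 F"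
    using mass_gain[OF N F c] s by auto
  moreover have "real q / (real N + 1) \<le> 26 / 25" using c(2) N by (simp add: field_simps)
  ultimately show ?thesis by (simp split: if_splits)
qed

text \<open>Deleting a point of degree 1 returns 1/2 against a loss of 29/50 and one more missing
  set; a point of larger degree gains at least 3/4 against q/(N + 1) <= 1.
  \<open>mass_ge_exact\<close> needs this for degree 1, where a loss of 29/50 would exceed the 1/2
  returned.\<close>

lemma mass_ge_loss_quarter:
  assumes N: "49 \<le> N" and F: "hereditary F" "finite (supp F)"
    and c: "card F + q = 2 ^ N" "q \<le> N + 1" and s: "N \<le> card (supp F)"
  shows "cube_mass N - real q / (real N + 1) - 1 / 4 \<le> mass 1 F"
proof (cases "card (supp F) = N")
  case True
  then show ?thesis using mass_ge_near_cube[OF N F c(1)] c(2) by linarith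
next
  case False
  have q: "q \<le> N + 3" and s1: "N + 1 \<le> card (supp F)" using c(2) s False by auto
  obtain z where z: "z \<in> supp F" "1 \<le> card (link F z)" "cube_mass N - 2 * real q / (real N + 1)
      + (if card (link F z) = 1 then 23 / 50 else if card (link F z) \<le> 3 then 3 / 4 else 1) \<le> mass 1 F"
    using mass_gain[OF N F c(1) q s1] by blast
  have n1: "1 / (real N + 1) \<le> 1 / 50" using N by (simp add: field_simps)
  show ?thesis
  proof (cases "card (link F z) = 1")
    case True
    have "cube_mass N - real (q + 1) / (real N + 1) - 29 / 50 \<le> mass 1 (del F z)"
      using card_del_add[OF F c(1), of z] True c(2) s1 z(1) F
      by (intro mass_ge_loss_29_50 N hereditary_del) (auto simp: supp_del)
    moreover have "mass 1 (del F z) + 1 / 2 \<le> mass 1 F"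
      using mass_link_ge[OF F, of z 0] True by (simp add: om_def)
    moreover have "real (q + 1) / (real N + 1) = real q / (real N + 1) + 1 / (real N + 1)"
      by (simp add: add_divide_distrib)
    ultimately show ?thesis using n1 by linarith
  next
    case False
    have "real q / (real N + 1) \<le> 1" using c(2) N by (simp add: field_simps)
    moreover have "cube_mass N - 2 * real q / (real N + 1) + 3 / 4 \<le> mass 1 F"
      using z(3) False by (auto split: if_splits)
    ultimately show ?thesis by linarith
  qed
qed

text \<open>Let t be the degree of the point z supplied by \<open>mass_gain\<close>. For t >= 4 the
  gain 1 covers q/(N + 1). For t = 1, 2, 3 deleting z returns 1/2, 5/6, 17/16, more than the loss
  1/4, 29/50, 29/50 of the smaller family plus t/(N + 1) <= t/50. The spare support point keeps the
  smaller family on at least N points.\<close>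

lemma mass_ge_exact:
  assumes N: "49 \<le> N" and F: "hereditary F" "finite (supp F)"
    and c: "card F + q = 2 ^ N" "q \<le> N" and s: "N + 1 \<le> card (supp F)"
  shows "cube_mass N - real q / (real N + 1) \<le> mass 1 F"
proof -
  have q: "q \<le> N + 3" using c(2) by auto
  obtain z where z: "z \<in> supp F" "1 \<le> card (link F z)" "cube_mass N - 2 * real q / (real N + 1)
      + (if card (link F z) = 1 then 23 / 50 else if card (link F z) \<le> 3 then 3 / 4 else 1) \<le> mass 1 F"
    using mass_gain[OF N F c(1) q s] by blast
  have n1: "1 / (real N + 1) \<le> 1 / 50" using N by (simp add: field_simps)
  define t where "t = card (link F z)"
  consider "t = 1" | "t = 2" | "t = 3" | "4 \<le> t" using z(2) t_def by linarith
  then show ?thesis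
  proof cases
    case 1
    have "cube_mass N - real (q + 1) / (real N + 1) - 1 / 4 \<le> mass 1 (del F z)"
      using card_del_add[OF F c(1), of z] 1 t_def c(2) s z(1) F
      by (intro mass_ge_loss_quarter N hereditary_del) (auto simp: supp_del)
    moreover have "mass 1 (del F z) + 1 / 2 \<le> mass 1 F"
      using mass_link_ge[OF F, of z 0] 1 t_def by (simp add: om_def)
    moreover have "real (q + 1) / (real N + 1) = real q / (real N + 1) + 1 * (1 / (real N + 1))"
      by (simp add: add_divide_distrib)
    ultimately show ?thesis using n1 by linarith
  next
    case 2
    have "cube_mass N - real (q + 2) / (real N + 1) - 29 / 50 \<le> mass 1 (del F z)"
      using card_del_add[OF F c(1), of z] 2 t_def c(2) s z(1) F
      by (intro mass_ge_loss_29_50 N hereditary_del) (auto simp: supp_del)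
    moreover have "mass 1 (del F z) + 5 / 6 \<le> mass 1 F"
      using mass_link_ge[OF F, of z 1] 2 t_def by (simp add: om_def)
    moreover have "real (q + 2) / (real N + 1) = real q / (real N + 1) + 2 * (1 / (real N + 1))"
      by (simp add: add_divide_distrib)
    ultimately show ?thesis using n1 by linarith
  next
    case 3
    have "cube_mass N - real (q + 3) / (real N + 1) - 29 / 50 \<le> mass 1 (del F z)"
      using card_del_add[OF F c(1), of z] 3 t_def c(2) s z(1) F
      by (intro mass_ge_loss_29_50 N hereditary_del) (auto simp: supp_del)
    moreover have "mass 1 (del F z) + 17 / 16 \<le> mass 1 F"
      using mass_link_ge[OF F, of z 2] 3 t_def by (simp add: om_def power2_eq_square)
    moreover have "real (q + 3) / (real N + 1) = real q / (real N + 1) + 3 * (1 / (real N + 1))"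
      by (simp add: add_divide_distrib)
    ultimately show ?thesis using n1 by linarith
  next
    case 4
    have "real q / (real N + 1) \<le> 1" using c(2) N by (simp add: field_simps)
    moreover have "cube_mass N - 2 * real q / (real N + 1) + 1 \<le> mass 1 F"
      using z(3) 4 t_def by (auto split: if_splits)
    ultimately show ?thesis by linarith
  qed
qed

text \<open>The family may exceed the range of the chord bound, so it is thinned to exactly
  \<open>2 ^ N - q\<close> sets; keeping N + 1 singletons preserves the spare support point.\<close>

lemma mass_ge_large_support:
  assumes N: "49 \<le> N" and F: "hereditary F" "finite (supp F)"
    and c: "2 ^ N \<le> card F + q" "q \<le> N" and s: "N + 1 \<le> card (supp F)"
  shows "cube_mass N - real q / (real N + 1) \<le> mass 1 F"
proof -
  obtain S where S: "S \<subseteq> supp F" "card S = N + 1" using s by (metis obtain_subset_with_card_n)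
  have fS: "finite S" using S F(2) finite_subset by blast
  define K where "K = insert {} ((\<lambda>x. {x}) ` S)"
  have hK: "hereditary K" unfolding hereditary_def K_def by auto
  have fF: "finite F" using F finite_if_finite_supp by blast
  have sing: "{x} \<in> F" if "x \<in> S" for x using that S(1) by (auto simp: supp_def)
  have "S \<noteq> {}" using S(2) by auto
  then have "{} \<in> F" using sing hereditary_empty_mem[OF F(1)] by blast
  then have KF: "K \<subseteq> F" using sing by (auto simp: K_def)
  have "card K = N + 2" unfolding K_def using fS S(2) by (subst card_insert_disjoint) (auto simp: card_image)
  moreover have big: "2 * N + 2 \<le> 2 ^ N"
  proof -
    have "2 * N + 2 \<le> 16 * (N + 1) ^ 1" by simp
    also have "\<dots> \<le> 16 * (N + 1) ^ 4" by (intro mult_left_mono power_increasing) auto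
    finally show ?thesis using two_power_ge[OF N] by linarith
  qed
  ultimately have "card K \<le> 2 ^ N - q" "2 ^ N - q \<le> card F" using c by linarith+
  then obtain G where G: "hereditary G" "K \<subseteq> G" "G \<subseteq> F" "card G = 2 ^ N - q"
    using hereditary_between[OF hK KF _ _ F(1) fF] by blast
  have "cube_mass N - real q / (real N + 1) \<le> mass 1 G"
  proof (rule mass_ge_exact[OF N G(1) _ _ c(2)])
    have "supp G \<subseteq> supp F" using G(3) by (auto simp: supp_def)
    then show fs: "finite (supp G)" using F(2) finite_subset by blast
    show "card G + q = 2 ^ N" using G(4) c(2) big by linarith
    have "S \<subseteq> supp G" using G(2) by (auto simp: K_def supp_def)
    then show "N + 1 \<le> card (supp G)" using S(2) card_mono[OF fs, of S] by simp
  qed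
  also have "\<dots> \<le> mass 1 F" unfolding mass_def using G(3) fF by (intro sum_mono2) auto
  finally show ?thesis .
qed

section \<open>Blocks\<close>

lemma mass_mono: "finite G \<Longrightarrow> F \<subseteq> G \<Longrightarrow> mass j F \<le> mass j G"
  unfolding mass_def by (intro sum_mono2) auto

lemma mass_containing:
  assumes "finite Y" "F \<subseteq> Pow Y"
  shows "mass j {A \<in> F. x \<in> A} = mass (Suc j) (link F x)"
  unfolding mass_def insert_image_link[symmetric] sum.reindex[OF inj_on_insert_link]
  using card_insert_link[OF assms] by (auto intro!: sum.cong)

text \<open>17/48 is \<open>om 2\<close>, the slope of the linear bound for up to
  \<open>2 ^ 2\<close> members; a larger family is cut down to four.\<close>

lemma mass_two_ge_min:
  assumes "finite Y" "F \<subseteq> Pow Y" "hereditary F"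
  shows "17 / 48 * min (real (card F)) 4 \<le> mass 2 F"
proof -
  have fF: "finite F" using assms finite_subset by blast
  have om2: "om 2 = 17 / 48" by (simp add: om_def power2_eq_square)
  show ?thesis
  proof (cases "card F \<le> 4")
    case True
    then show ?thesis using mass_two_ge_linear[OF assms, of 2] om2 by simp
  next
    case False
    have h: "hereditary {}" by (simp add: hereditary_def)
    obtain G where G: "hereditary G" "G \<subseteq> F" "card G = 4"
      using hereditary_between[OF h _ _ _ assms(3) fF, of 4] False by auto
    have "real (card G) * om 2 \<le> mass 2 G"
      using mass_two_ge_linear[OF assms(1) _ G(1), of 2] G assms(2) by simp
    also have "\<dots> \<le> mass 2 F" using mass_mono[OF fF G(2)] .
    finally show ?thesis using om2 G(3) False by simp
  qed
qed

text \<open>The sets meeting Z are not hereditary, so they are sorted by one point of Z after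
  another: those through z come from a link, the others from the hereditary family
  \<open>del F z\<close>. Truncation at 4 is subadditive, so the bounds add up.\<close>

lemma mass_meeting_ge_min:
  assumes "finite Z" "finite Y" "F \<subseteq> Pow Y" "hereditary F"
  shows "17 / 48 * min (real (card {A \<in> F. A \<inter> Z \<noteq> {}})) 4 \<le> mass 1 {A \<in> F. A \<inter> Z \<noteq> {}}"
  using assms
proof (induction Z arbitrary: F rule: finite_induct)
  case empty
  then show ?case by (simp add: mass_def)
next
  case (insert z Z)
  let ?A = "{A \<in> F. z \<in> A}" and ?B = "{A \<in> del F z. A \<inter> Z \<noteq> {}}"
  have fF: "finite F" using insert.prems finite_subset by blast
  have f: "finite ?A" "finite ?B" using fF by (auto simp: del_def)
  have dis: "?A \<inter> ?B = {}" by (auto simp: del_def)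
  have eq: "{A \<in> F. A \<inter> insert z Z \<noteq> {}} = ?A \<union> ?B" by (auto simp: del_def)
  have "del F z \<subseteq> Pow Y" using insert.prems(2) by (auto simp: del_def)
  then have IH: "17 / 48 * min (real (card ?B)) 4 \<le> mass 1 ?B"
    by (rule insert.IH[OF insert.prems(1) _ hereditary_del[OF insert.prems(3)]])
  have "17 / 48 * min (real (card (link F z))) 4 \<le> mass 2 (link F z)"
    using mass_two_ge_min[OF _ link_subset_Pow[OF insert.prems(2)] hereditary_link[OF insert.prems(3)]]
      insert.prems(1) by blast
  also have "\<dots> = mass 1 ?A"
    using mass_containing[OF insert.prems(1,2), of 1 z] by (simp add: numeral_2_eq_2)
  finally have "17 / 48 * min (real (card ?A)) 4 \<le> mass 1 ?A" unfolding card_link .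
  moreover have "card (?A \<union> ?B) = card ?A + card ?B" by (rule card_Un_disjoint[OF f dis])
  moreover have "mass 1 (?A \<union> ?B) = mass 1 ?A + mass 1 ?B"
    unfolding mass_def by (rule sum.union_disjoint[OF f dis])
  ultimately show ?case unfolding eq using IH by (simp add: min_def split: if_splits)
qed

section \<open>Families with large degrees and their blocks\<close>

lemma card_subsets_containing:
  assumes "finite B" and v: "v \<in> B"
  shows "card {A. A \<subseteq> B \<and> v \<in> A} = 2 ^ (card B - 1)"
proof -
  have "{A. A \<subseteq> B \<and> v \<in> A} = insert v ` Pow (B - {v})"
  proof
    show "{A. A \<subseteq> B \<and> v \<in> A} \<subseteq> insert v ` Pow (B - {v})"
    proof
      fix A assume "A \<in> {A. A \<subseteq> B \<and> v \<in> A}"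
      then have "A = insert v (A - {v})" "A - {v} \<in> Pow (B - {v})" by auto
      then show "A \<in> insert v ` Pow (B - {v})" by blast
    qed
  qed (use v in auto)
  moreover have "inj_on (insert v) (Pow (B - {v}))" by (rule inj_onI) (auto dest!: insert_ident[THEN iffD1, rotated 2])
  ultimately show ?thesis using assms by (simp add: card_image card_Pow)
qed

text \<open>The condition \<open>degree\<close> says that all degrees exceed s = 2^(d-1) - c; its
  additive form avoids truncated subtraction.\<close>

locale dense_family =
  fixes V :: "'a set" and F :: "'a set set" and d c :: nat
  assumes finite_V: "finite V" and F_subset: "F \<subseteq> Pow V" and hered: "hereditary F"
    and d_ge: "50 \<le> d" and c_ge: "1 \<le> c" and c_le: "c \<le> d"
    and degree: "\<And>x. x \<in> V \<Longrightarrow> 2 ^ (d - 1) < card {A \<in> F. x \<in> A} + c"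
begin

definition weight :: "'a \<Rightarrow> real" where
  "weight x = (\<Sum>A\<in>{A \<in> F. x \<in> A}. 1 / real (card A))"

lemma finite_F: "finite F"
  using finite_V F_subset finite_subset by blast

lemma finite_member: "A \<in> F \<Longrightarrow> finite A"
  using finite_V F_subset finite_subset by blast

lemma F_D: "A \<in> F \<Longrightarrow> B \<subseteq> A \<Longrightarrow> B \<in> F"
  using hered hereditaryD by blast

lemma empty_mem:
  assumes "V \<noteq> {}"
  shows "{} \<in> F"
proof (rule hereditary_empty_mem[OF hered])
  obtain x where "x \<in> V" using assms by blast
  moreover have "d - 1 < 2 ^ (d - 1)" by (rule less_exp)
  ultimately have "0 < card {A \<in> F. x \<in> A}" using degree[of x] c_le by linarith
  then show "F \<noteq> {}" by auto
qed

lemma weight_eq_mass: "weight x = mass 1 (link F x)"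
proof -
  have "weight x = mass 0 {A \<in> F. x \<in> A}" by (simp add: weight_def mass_def)
  then show ?thesis using mass_containing[OF finite_V F_subset, of 0 x] by simp
qed

end

locale block = dense_family +
  fixes B :: "'a set" and x0 :: 'a
  assumes B_subset: "B \<subseteq> V" and card_B: "card B = d" and x0: "x0 \<in> B"
    and x0_only: "\<And>A. A \<in> F \<Longrightarrow> x0 \<in> A \<Longrightarrow> A \<subseteq> B"
begin

definition M where "M = Pow B - F"

definition out where "out v = {A \<in> F. v \<in> A \<and> \<not> A \<subseteq> B}"

definition outw :: "'a \<Rightarrow> real" where "outw v = (\<Sum>A\<in>out v. 1 / real (card A))"

lemma finite_B: "finite B"
  using B_subset finite_V finite_subset by blast

lemma finite_M: "finite M"
  unfolding M_def using finite_B by simp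

lemma finite_out: "finite (out v)"
  unfolding out_def using finite_F by simp

lemma M_up: "A \<in> M \<Longrightarrow> A \<subseteq> C \<Longrightarrow> C \<subseteq> B \<Longrightarrow> C \<in> M"
  unfolding M_def using F_D by blast

lemma outw_nonneg: "0 \<le> outw v"
  unfolding outw_def by (simp add: sum_nonneg)

lemma card_containing_Pow: "v \<in> B \<Longrightarrow> card {A. A \<subseteq> B \<and> v \<in> A} = 2 ^ (d - 1)"
  using card_subsets_containing[OF finite_B] card_B by simp

lemma card_M_containing_le:
  assumes v: "v \<in> B"
  shows "card {A \<in> M. v \<in> A} < c + card (out v)"
proof -
  have "{A. A \<subseteq> B \<and> v \<in> A} = {A \<in> M. v \<in> A} \<union> {A \<in> F. A \<subseteq> B \<and> v \<in> A}" by (auto simp: M_def)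
  then have 1: "2 ^ (d - 1) = card {A \<in> M. v \<in> A} + card {A \<in> F. A \<subseteq> B \<and> v \<in> A}"
    unfolding card_containing_Pow[OF v, symmetric]
    using finite_M finite_F by (simp add: M_def) (subst card_Un_disjoint, auto)
  have "{A \<in> F. v \<in> A} = {A \<in> F. A \<subseteq> B \<and> v \<in> A} \<union> out v" by (auto simp: out_def)
  then have 2: "card {A \<in> F. v \<in> A} = card {A \<in> F. A \<subseteq> B \<and> v \<in> A} + card (out v)"
    using finite_out finite_F by simp (subst card_Un_disjoint, auto simp: out_def)
  show ?thesis using degree[of v] v B_subset 1 2 by auto
qed

lemma out_x0: "out x0 = {}"
  unfolding out_def using x0_only by blast

text \<open>No set through \<open>x0\<close> leaves the block, so at most c - 1 missing sets contain
  it; adding \<open>x0\<close> injects the missing sets that avoid it into those.\<close>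

lemma card_M_le: "card M \<le> 2 * (c - 1)"
proof -
  have 1: "card {A \<in> M. x0 \<in> A} \<le> c - 1"
    using card_M_containing_le[OF x0] out_x0 by simp
  have "insert x0 ` {A \<in> M. x0 \<notin> A} \<subseteq> {A \<in> M. x0 \<in> A}"
    using M_up x0 by (auto simp: M_def intro: F_D)
  moreover have "inj_on (insert x0) {A \<in> M. x0 \<notin> A}" by (rule inj_onI) (auto dest!: insert_ident[THEN iffD1, rotated 2])
  ultimately have 2: "card {A \<in> M. x0 \<notin> A} \<le> card {A \<in> M. x0 \<in> A}"
    using card_mono[of "{A \<in> M. x0 \<in> A}" "insert x0 ` {A \<in> M. x0 \<notin> A}"] finite_M
    by (simp add: card_image)
  have "M = {A \<in> M. x0 \<in> A} \<union> {A \<in> M. x0 \<notin> A}" by blast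
  then have "card M \<le> card {A \<in> M. x0 \<in> A} + card {A \<in> M. x0 \<notin> A}"
    by (metis card_Un_le)
  then show ?thesis using 1 2 by linarith
qed

lemma codim_M:
  assumes "A \<in> M"
  shows "8 * (d - card A) \<le> d"
proof -
  have "2 ^ (card B - card A) \<le> card M"
    using assms M_up by (intro two_power_codim_le finite_B finite_M) (auto simp: M_def)
  also have "\<dots> \<le> 2 * (c - 1)" by (rule card_M_le)
  also have "\<dots> \<le> 2 * (d - 1 + 1)" using c_le by simp
  finally have "8 * (card B - card A) \<le> d - 1 + 1"
    using d_ge by (intro small_power_of_two_exponent) auto
  then show ?thesis unfolding card_B using d_ge by simp
qed

lemma outw_eq_mass:
  "outw v = mass 1 {C \<in> link F v. C \<inter> (V - insert v B) \<noteq> {}}" (is ?w)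
  "card (out v) = card {C \<in> link F v. C \<inter> (V - insert v B) \<noteq> {}}" (is ?c)
  if v: "v \<in> B"
proof -
  let ?L = "{C \<in> link F v. C \<inter> (V - insert v B) \<noteq> {}}"
  have im: "out v = insert v ` ?L"
  proof
    show "out v \<subseteq> insert v ` ?L"
    proof
      fix A assume A: "A \<in> out v"
      then have "A = insert v (A - {v})" by (auto simp: out_def)
      moreover have "A - {v} \<in> link F v" using A by (auto simp: out_def link_def insert_absorb)
      moreover have "(A - {v}) \<inter> (V - insert v B) \<noteq> {}" using A v F_subset by (auto simp: out_def)
      ultimately show "A \<in> insert v ` ?L" by blast
    qed
    show "insert v ` ?L \<subseteq> out v" using v by (auto simp: out_def link_def)
  qed
  have inj: "inj_on (insert v) ?L" using inj_on_insert_link by (rule inj_on_subset) blast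
  show ?c unfolding im by (rule card_image[OF inj])
  show ?w unfolding outw_def im sum.reindex[OF inj] mass_def
    using card_insert_link[OF finite_V F_subset] by (auto intro!: sum.cong)
qed

lemma outw_ge_min:
  assumes "v \<in> B"
  shows "17 / 48 * min (real (card (out v))) 4 \<le> outw v"
  unfolding outw_eq_mass[OF assms]
  using finite_V link_subset_Pow[OF F_subset] hereditary_link[OF hered]
  by (intro mass_meeting_ge_min[of _ "V - {v}"]) auto

text \<open>By heredity a set through v that leaves the block contains a pair \<open>{v, z}\<close>
  that leaves it too, and this pair alone weighs 1/2.\<close>

lemma outw_ge_half:
  assumes "v \<in> B" "out v \<noteq> {}"
  shows "1 / 2 \<le> outw v"
proof -
  obtain A where A: "A \<in> F" "v \<in> A" "\<not> A \<subseteq> B" using assms(2) by (auto simp: out_def)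
  then obtain z where z: "z \<in> A" "z \<notin> B" by blast
  have "{v, z} \<in> F" using F_D[OF A(1), of "{v, z}"] A z by blast
  then have m: "{v, z} \<in> out v" using z by (auto simp: out_def)
  have "card {v, z} = 2" using z assms(1) by (auto simp: card_2_iff)
  then have "1 / 2 = 1 / real (card {v, z})" by simp
  also have "\<dots> \<le> outw v" unfolding outw_def
    by (rule member_le_sum[OF m _ finite_out]) auto
  finally show ?thesis .
qed

lemma sum_card_inter:
  fixes W :: "'a set" and E :: "'a set set"
  assumes "finite W" "finite E"
  shows "(\<Sum>v\<in>W. card {A \<in> E. v \<in> A}) = (\<Sum>A\<in>E. card (A \<inter> W))"
proof -
  have "(\<Sum>v\<in>W. card {A \<in> E. v \<in> A}) = (\<Sum>A\<in>E. card {v \<in> W. v \<in> A})"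
    using sum.swap_restrict[OF assms, of "\<lambda>_ _. 1::nat" "\<lambda>v A. v \<in> A"] by simp
  also have "\<dots> = (\<Sum>A\<in>E. card (A \<inter> W))"
    by (intro sum.cong refl arg_cong[of _ _ card]) auto
  finally show ?thesis .
qed

lemma weight_block:
  assumes v: "v \<in> B"
  shows "weight v = (\<Sum>A\<in>{A \<in> F. A \<subseteq> B \<and> v \<in> A}. 1 / real (card A)) + outw v"
proof -
  have "{A \<in> F. v \<in> A} = {A \<in> F. A \<subseteq> B \<and> v \<in> A} \<union> out v" by (auto simp: out_def)
  then show ?thesis unfolding weight_def outw_def
    using finite_F finite_out by (simp, subst sum.union_disjoint) (auto simp: out_def)
qed

text \<open>Each nonempty member inside the block distributes total weight 1 over its points, all of
  which lie in B.\<close>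

lemma sum_weight_block:
  "(\<Sum>v\<in>B. weight v) = 2 ^ d - 1 - real (card M) + (\<Sum>v\<in>B. outw v)"
proof -
  let ?G = "{A \<in> F. A \<subseteq> B}"
  have emp: "{} \<in> F"
    using x0 B_subset by (intro empty_mem) auto
  have fG: "finite ?G" using finite_F by simp
  have "(\<Sum>v\<in>B. \<Sum>A\<in>{A \<in> F. A \<subseteq> B \<and> v \<in> A}. 1 / real (card A))
      = (\<Sum>v\<in>B. \<Sum>A\<in>{A \<in> ?G. v \<in> A}. 1 / real (card A))"
    by (intro sum.cong refl) auto
  also have "\<dots> = (\<Sum>A\<in>?G. \<Sum>v\<in>{v \<in> B. v \<in> A}. 1 / real (card A))"
    using sum.swap_restrict[OF finite_B fG, of "\<lambda>_ A. 1 / real (card A)" "\<lambda>v A. v \<in> A"] by simp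
  also have "\<dots> = (\<Sum>A\<in>?G. if A = {} then 0 else 1)"
  proof (rule sum.cong)
    fix A assume A: "A \<in> ?G"
    then have "{v \<in> B. v \<in> A} = A" by blast
    then show "(\<Sum>v\<in>{v \<in> B. v \<in> A}. 1 / real (card A)) = (if A = {} then 0 else 1)"
      using A finite_member by auto
  qed simp
  also have "\<dots> = (\<Sum>A\<in>?G - {{}}. 1)"
    using fG by (intro sum.mono_neutral_cong_right) auto
  also have "\<dots> = real (card ?G) - 1"
  proof -
    have "card ?G = Suc (card (?G - {{}}))" using fG emp by (intro card.remove) auto
    then show ?thesis by simp
  qed
  also have "real (card ?G) = 2 ^ d - real (card M)"
  proof -
    have "Pow B = ?G \<union> M" "?G \<inter> M = {}" by (auto simp: M_def)
    then have "card (Pow B) = card ?G + card M" using fG finite_M by (metis card_Un_disjoint)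
    then have "2 ^ d = card ?G + card M" using finite_B card_B by (simp add: card_Pow)
    then have "real (2 ^ d) = real (card ?G) + real (card M)" by simp
    then show ?thesis by simp
  qed
  finally have "(\<Sum>v\<in>B. \<Sum>A\<in>{A \<in> F. A \<subseteq> B \<and> v \<in> A}. 1 / real (card A)) = 2 ^ d - real (card M) - 1" .
  moreover have "(\<Sum>v\<in>B. weight v) = (\<Sum>v\<in>B. \<Sum>A\<in>{A \<in> F. A \<subseteq> B \<and> v \<in> A}. 1 / real (card A)) + (\<Sum>v\<in>B. outw v)"
    unfolding sum.distrib[symmetric] by (intro sum.cong refl weight_block)
  ultimately show ?thesis by simp
qed

text \<open>If more than c - 1 sets are missing, then every point without neighbours outside the block
  is avoided by some missing set, hence so is the block minus that point. These forced sets use up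
  almost all of the missing sets such a point may lie in, which leaves few others when many
  points are of that kind; when few are, the points with neighbours outside have many of them.\<close>
lemma card_M_le_outw:
  "real (card M) + 1 \<le> real c + (\<Sum>v\<in>B. outw v) + (if c = d then 1 / 2 else 0)"
proof (cases "card M + 1 \<le> c")
  case True
  then have "real (card M) + 1 \<le> real c" by linarith
  moreover have "0 \<le> (\<Sum>v\<in>B. outw v)" using outw_nonneg by (simp add: sum_nonneg)
  ultimately show ?thesis by simp
next
  case False
  define U where "U = {v \<in> B. out v \<noteq> {}}"
  define W where "W = B - U"
  \<comment> \<open>q counts the missing sets beyond the c - 1 that the bound tolerates; the sets
    leaving the block have to pay for them.\<close>
  define q where "q = card M + 1 - c"
  define S where "S = (\<Sum>v\<in>B. outw v)"
  have q: "card M + 1 = c + q" "1 \<le> q" using False by (auto simp: q_def)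
  have fin: "finite U" "finite W" using finite_B by (auto simp: U_def W_def)
  have UB: "U \<subseteq> B" by (auto simp: U_def)
  have cUW: "card W + card U = d" unfolding W_def using card_Diff_subset[OF fin(1) UB] card_mono[OF finite_B UB] card_B by simp
  have x0W: "x0 \<in> W" using x0 out_x0 by (auto simp: W_def U_def)
  have MW: "card {A \<in> M. v \<in> A} < c" if "v \<in> W" for v
    using card_M_containing_le[of v] that by (auto simp: W_def U_def)
  have BM: "B - {v} \<in> M" if v: "v \<in> W" for v
  proof -
    have "card {A \<in> M. v \<in> A} \<noteq> card M" using MW[OF v] False by linarith
    then have "{A \<in> M. v \<in> A} \<noteq> M" by metis
    then obtain A where A: "A \<in> M" "v \<notin> A" by blast
    then have "A \<subseteq> B - {v}" by (auto simp: M_def)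
    then show ?thesis using M_up[OF A(1)] by blast
  qed
  have B_M: "B \<in> M" using M_up[OF BM[OF x0W]] by blast
  define M0 where "M0 = insert B ((\<lambda>v. B - {v}) ` W)"
  have inj: "inj_on (\<lambda>v. B - {v}) W" by (rule inj_onI) (auto simp: W_def)
  have M0M: "M0 \<subseteq> M" unfolding M0_def using B_M BM by blast
  have cM0: "card M0 = card W + 1"
    unfolding M0_def using fin inj by (subst card_insert_disjoint) (auto simp: card_image W_def)
  have cM0v: "card {A \<in> M0. v \<in> A} = card W" if v: "v \<in> W" for v
  proof -
    have "{A \<in> M0. v \<in> A} = insert B ((\<lambda>w. B - {w}) ` (W - {v}))"
      unfolding M0_def using v by (auto simp: W_def)
    moreover have "inj_on (\<lambda>v. B - {v}) (W - {v})" using inj by (rule inj_on_subset) blast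
    moreover have "B \<notin> (\<lambda>w. B - {w}) ` (W - {v})" by (auto simp: W_def)
    ultimately have "card {A \<in> M0. v \<in> A} = Suc (card (W - {v}))"
      using fin by (simp add: card_image)
    then show ?thesis using card.remove[OF fin(2) v] by simp
  qed
  define E where "E = M - M0"
  have fE: "finite E" using finite_M by (simp add: E_def)
  have cE: "card E + card W + 1 = card M"
    unfolding E_def using card_Diff_subset[OF finite_subset[OF M0M finite_M] M0M] card_mono[OF finite_M M0M] cM0 by simp
  have Ev: "card {A \<in> E. v \<in> A} + card W < c" if v: "v \<in> W" for v
  proof -
    have "{A \<in> M. v \<in> A} = {A \<in> E. v \<in> A} \<union> {A \<in> M0. v \<in> A}" using M0M by (auto simp: E_def)
    moreover have "{A \<in> E. v \<in> A} \<inter> {A \<in> M0. v \<in> A} = {}" by (auto simp: E_def)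
    ultimately have "card {A \<in> M. v \<in> A} = card {A \<in> E. v \<in> A} + card {A \<in> M0. v \<in> A}"
      using fE finite_subset[OF M0M finite_M] by (simp add: card_Un_disjoint)
    then show ?thesis using MW[OF v] cM0v[OF v] by simp
  qed
  have Wc: "card W < c" using Ev[OF x0W] by linarith
  have SU: "real (card U) / 2 \<le> S"
  proof -
    have "real (card U) / 2 = (\<Sum>v\<in>U. 1 / 2)" by simp
    also have "\<dots> \<le> (\<Sum>v\<in>U. outw v)"
    proof (rule sum_mono)
      fix v assume "v \<in> U"
      then show "1 / 2 \<le> outw v" by (intro outw_ge_half) (auto simp: U_def)
    qed
    also have "\<dots> \<le> S" unfolding S_def using finite_B UB outw_nonneg by (intro sum_mono2) auto
    finally show ?thesis .
  qed
  have rq: "real (card M) + 1 = real c + real q" using q(1) by linarith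
  have "real q \<le> S + (if c = d then 1 / 2 else 0)"
  proof (cases "(c < d \<and> 2 * q \<le> card U) \<or> (c = d \<and> 2 * q \<le> card U + 1)")
    case True
    then show ?thesis
    proof
      assume a: "c < d \<and> 2 * q \<le> card U"
      then have "2 * real q \<le> real (card U)" by linarith
      then show ?thesis using SU a by simp
    next
      assume a: "c = d \<and> 2 * q \<le> card U + 1"
      then have "2 * real q \<le> real (card U) + 1" by linarith
      then show ?thesis using SU a by simp
    qed
  next
    case few: False
    \<comment> \<open>A point of W lies in \<open>card W\<close> of the forced missing sets, all but
      its own coatom, and so in at most e of the others.\<close>
    define e where "e = c - 1 - card W"
    have e: "e + card W + 1 = c" using Wc by (simp add: e_def)
    have cEq: "card E + 1 = e + q" using cE e q(1) by linarith
    have e3: "e + 3 \<le> 2 * q" using few e cUW c_le by auto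
    have cU: "card U + 1 \<le> 2 * q" using few c_le by auto
    have codim: "real (card A) \<ge> real d - real d / 8" if "A \<in> M" for A
      using codim_M[OF that] by linarith
    \<comment> \<open>Count incidences between E and W: a set of E omits at most d/8 points of the
      block, a point of W lies in at most e sets of E, and E has e + q - 1 members. With
      \<open>e + 3 \<le> 2 * q\<close> this bounds \<open>card W\<close> by 3d/8, so at least 5d/8
      points have sets leaving the block.\<close>
    have DW: "8 * card W \<le> 3 * d"
    proof -
      have *: "real (card (A \<inter> W)) \<ge> real (card W) - real d / 8" if A: "A \<in> E" for A
      proof -
        have AM: "A \<in> M" using A by (simp add: E_def)
        then have AB: "A \<subseteq> B" by (auto simp: M_def)
        then have fA: "finite A" using finite_B finite_subset by blast
        have "card (A \<union> W) \<le> card B" using AB finite_B by (intro card_mono) (auto simp: W_def)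
        then have "card A + card W \<le> d + card (A \<inter> W)"
          using card_Un_Int[OF fA fin(2)] card_B by simp
        then show ?thesis using codim[OF AM] by linarith
      qed
      have "real (card E) * (real (card W) - real d / 8) \<le> real (\<Sum>A\<in>E. card (A \<inter> W))"
        using sum_mono[OF *, of E id] by (simp add: of_nat_sum)
      also have "(\<Sum>A\<in>E. card (A \<inter> W)) = (\<Sum>v\<in>W. card {A \<in> E. v \<in> A})"
        by (rule sum_card_inter[OF fin(2) fE, symmetric])
      also have "\<dots> \<le> card W * e"
        using sum_bounded_above[of W "\<lambda>v. card {A \<in> E. v \<in> A}" e] Ev e by fastforce
      finally have "real (card E) * (real (card W) - real d / 8) \<le> real (card W) * real e" by simp
      moreover have "real (card E) = real e + real q - 1" using cEq by linarith
      ultimately have "(real e + real q - 1) * (real (card W) - real d / 8) \<le> real (card W) * real e" by simp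
      moreover have "(p - 1) * w \<le> (x + p - 1) * z" if "(x + p - 1) * (w - z) \<le> w * x" for p w x z :: real
        using that by (simp add: algebra_simps)
      ultimately have 1: "(real q - 1) * real (card W) \<le> (real e + real q - 1) * (real d / 8)" by blast
      have "real e + 3 \<le> 2 * real q" using e3 by linarith
      then have 2: "real e + real q - 1 \<le> 3 * (real q - 1)" and q2: "1 < real q" by simp_all
      have "(real e + real q - 1) * (real d / 8) \<le> 3 * (real q - 1) * (real d / 8)"
        by (rule mult_right_mono[OF 2]) simp
      also have "\<dots> = (real q - 1) * (3 * real d / 8)" by simp
      finally have "(real q - 1) * real (card W) \<le> (real q - 1) * (3 * real d / 8)"
        by (rule order_trans[OF 1])
      then have "real (card W) \<le> 3 * real d / 8" using q2 by (simp add: mult_le_cancel_left)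
      then show ?thesis by linarith
    qed
    have q5: "5 * real d / 16 \<le> real q" using DW cUW cU by linarith
    have qd: "real q \<le> real d" using card_M_le q(1) c_le c_ge by linarith
    have q4: "4 \<le> real q" using q5 d_ge by linarith
    \<comment> \<open>r v is the excess of missing sets through v over c - 1, so at least r v sets
      leave the block at v. For positive r v, since r v <= q and q >= 4, truncation at 4 keeps at
      least 4 * r v / q; this makes \<open>outw_ge_min\<close> linear with constant 4 * 17/48 =
      17/12.\<close>
    define r where "r v = real (card {A \<in> M. v \<in> A}) - (real c - 1)" for v
    have out_r: "17 / 12 * r v / real q \<le> outw v" if v: "v \<in> B" for v
    proof (cases "r v \<le> 0")
      case True
      then have "17 / 12 * r v / real q \<le> 0" using q4 by (simp add: divide_nonpos_pos)
      then show ?thesis using outw_nonneg[of v] by linarith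
    next
      case False
      have "card {A \<in> M. v \<in> A} \<le> card M" using finite_M by (intro card_mono) auto
      then have rq': "r v \<le> real q" unfolding r_def using rq by linarith
      have "r v \<le> real (card (out v))" using card_M_containing_le[OF v] unfolding r_def by linarith
      moreover have "4 * r v / real q \<le> 4" "4 * r v / real q \<le> r v"
        using rq' q4 False by (auto simp: field_simps)
      ultimately have "4 * r v / real q \<le> min (real (card (out v))) 4" by linarith
      then have "17 / 48 * (4 * r v / real q) \<le> 17 / 48 * min (real (card (out v))) 4"
        by (rule mult_left_mono) simp
      also have "\<dots> \<le> outw v" by (rule outw_ge_min[OF v])
      finally show ?thesis by simp
    qed
    have "(\<Sum>v\<in>B. card {A \<in> M. v \<in> A}) = (\<Sum>A\<in>M. card A)"
      unfolding sum_card_inter[OF finite_B finite_M] by (intro sum.cong refl arg_cong[of _ _ card]) (auto simp: M_def)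
    moreover have "real (card M) * (real d - real d / 8) \<le> (\<Sum>A\<in>M. real (card A))"
      using sum_mono[OF codim, of M id] by simp
    ultimately have mm: "real (card M) * (real d - real d / 8) \<le> (\<Sum>v\<in>B. real (card {A \<in> M. v \<in> A}))"
      by (simp flip: of_nat_sum)
    have "(\<Sum>v\<in>B. r v) = (\<Sum>v\<in>B. real (card {A \<in> M. v \<in> A})) - real d * (real c - 1)"
      unfolding r_def sum_subtractf by (simp add: card_B algebra_simps)
    then have "real (card M) * (real d - real d / 8) - real d * (real c - 1) \<le> (\<Sum>v\<in>B. r v)" using mm by linarith
    moreover have "real (card M) = real c - 1 + real q" using rq by linarith
    moreover have "real d * (real c - 1) \<le> real d * real d" using c_le by (intro mult_left_mono) auto
    moreover have "(7 * x * y - x * x) / 8 \<le> s"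
      if "(z + y) * (x - x / 8) - x * z \<le> s" "x * z \<le> x * x" for s x y z :: real
      using that by (simp add: field_simps)
    ultimately have R: "(7 * real d * real q - real d * real d) / 8 \<le> (\<Sum>v\<in>B. r v)" by metis
    have "real q \<le> 17 / 12 * (\<Sum>v\<in>B. r v) / real q"
    proof -
      \<comment> \<open>q lies between 5d/16 and d, so this product is nonnegative; together with q
        <= d it yields q^2 <= 17/12 * (7dq - d^2)/8.\<close>
      have "0 \<le> (real q - 5 * real d / 16) * (real d - real q)" using q5 qd by (intro mult_nonneg_nonneg) auto
      then have "5 * (real d * real d) + 16 * (real q * real q) \<le> 21 * (real d * real q)" by (simp add: field_simps)
      moreover have "real d * real q \<le> real d * real d" using qd by (intro mult_left_mono) auto
      moreover have "z \<le> 17 / 12 * ((7 * y - x) / 8)"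
        if "5 * x + 16 * z \<le> 21 * y" "y \<le> x" "0 \<le> x" for x y z :: real
        using that by simp
      moreover have "0 \<le> real d * real d" by simp
      ultimately have "real q * real q \<le> 17 / 12 * ((7 * (real d * real q) - real d * real d) / 8)"
        by blast
      also have "\<dots> \<le> 17 / 12 * (\<Sum>v\<in>B. r v)" using R by (simp add: mult.assoc)
      finally show ?thesis using q4 by (simp add: le_divide_eq)
    qed
    also have "\<dots> = (\<Sum>v\<in>B. 17 / 12 * r v / real q)"
      by (simp add: sum_distrib_left sum_divide_distrib)
    also have "\<dots> \<le> S" unfolding S_def by (intro sum_mono out_r)
    finally show ?thesis by simp
  qed
  then show ?thesis using rq unfolding S_def by linarith
qed

lemma sum_weight_block_ge:
  "2 ^ d - real c - (if c = d then 1 / 2 else 0) \<le> (\<Sum>v\<in>B. weight v)"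
  using card_M_le_outw unfolding sum_weight_block by linarith

end

section \<open>A lower bound for families with large degrees\<close>

lemma (in dense_family) d_minus_one: "d - 1 = Suc (d - 2)"
  using d_ge by simp

lemma (in dense_family) two_power_d_minus_one: "(2::nat) ^ (d - 1) = 2 * 2 ^ (d - 2)"
  unfolding d_minus_one by simp

context block
begin

text \<open>At most 2(d - 1) sets are missing, each of weight at most 1. So rough a bound suffices
  for points in several blocks, which have a large surplus.\<close>

lemma weight_inside_ge:
  assumes v: "v \<in> B"
  shows "(2 ^ d - real c) / real d - 2 * real d \<le> (\<Sum>A\<in>{A \<in> F. A \<subseteq> B \<and> v \<in> A}. 1 / real (card A))"
proof -
  have "link (Pow B) v = Pow (B - {v})" using v by (auto simp: link_def)
  then have "mass 0 {A \<in> Pow B. v \<in> A} = mass 1 (Pow (B - {v}))"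
    using mass_containing[OF finite_B, of "Pow B" 0 v] by simp
  moreover have "cube_mass (Suc (d - 2)) \<le> mass 1 (Pow (B - {v}))"
    using finite_B v card_B d_ge by (intro mass_Pow_ge) auto
  ultimately have 1: "cube_mass (d - 1) \<le> mass 0 {A \<in> Pow B. v \<in> A}"
    unfolding d_minus_one by simp
  have un: "{A \<in> Pow B. v \<in> A} = {A \<in> F. A \<subseteq> B \<and> v \<in> A} \<union> {A \<in> M. v \<in> A}"
    by (auto simp: M_def)
  have "mass 0 {A \<in> Pow B. v \<in> A} = mass 0 {A \<in> F. A \<subseteq> B \<and> v \<in> A} + mass 0 {A \<in> M. v \<in> A}"
    unfolding un mass_def using finite_F finite_M by (intro sum.union_disjoint) (auto simp: M_def)
  moreover have "mass 0 {A \<in> M. v \<in> A} \<le> real (card {A \<in> M. v \<in> A}) * 1"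
    unfolding mass_def by (intro sum_bounded_above) (auto simp: divide_le_eq_1)
  moreover have "real (card {A \<in> M. v \<in> A}) \<le> real (card M)"
    using finite_M by (auto intro: card_mono)
  moreover have "real (card M) \<le> 2 * (real d - 1)"
  proof -
    have "card M + 2 \<le> 2 * d" using card_M_le c_le c_ge by simp
    then have "real (card M + 2) \<le> real (2 * d)" by (simp only: of_nat_le_iff)
    then show ?thesis by simp
  qed
  moreover have "(2 ^ d - real c) / real d \<le> cube_mass (d - 1)"
    using d_ge c_ge by (simp add: cube_mass_def divide_right_mono)
  ultimately show ?thesis using 1 by (simp add: mass_def)
qed

text \<open>The cube has \<open>2 ^ (d - 2)\<close> sets through both points, at most 2d of them are
  missing, and each weighs at least 1/d. This is what a further block contributes to a
  point.\<close>

lemma weight_through_ge: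
  assumes y: "y \<in> B" "y \<noteq> x0"
  shows "4 * real d \<le> (\<Sum>A\<in>{A \<in> F. y \<in> A \<and> x0 \<in> A}. 1 / real (card A))"
proof -
  let ?I = "(\<lambda>C. insert y (insert x0 C)) ` Pow (B - {y, x0})"
  let ?S = "{A \<in> F. y \<in> A \<and> x0 \<in> A}"
  have "inj_on (\<lambda>C. insert y (insert x0 C)) (Pow (B - {y, x0}))"
    by (rule inj_onI) blast
  moreover have "card (B - {y, x0}) = d - 2" using y x0 card_B finite_B by (simp add: card_Diff_subset)
  ultimately have cI: "card ?I = 2 ^ (d - 2)" using finite_B by (simp add: card_image card_Pow)
  have "?I - M \<subseteq> ?S" using y x0 by (auto simp: M_def)
  then have "card (?I - M) \<le> card ?S" using finite_F by (intro card_mono) auto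
  moreover have "card ?I - card M \<le> card (?I - M)" by (rule diff_card_le_card_Diff[OF finite_M])
  moreover have "card M \<le> 2 * d" using card_M_le c_le by simp
  moreover have "4 * (d * d) + 2 * d \<le> 2 ^ (d - 2)"
  proof -
    have "16 * (d - 1 + 1) ^ 4 \<le> (2::nat) ^ (d - 1)" using d_ge by (intro two_power_ge) auto
    moreover have "(2::nat) ^ (d - 1) = 2 * 2 ^ (d - 2)" by (rule two_power_d_minus_one)
    moreover have "d - 1 + 1 = d" using d_ge by simp
    ultimately have 1: "8 * d ^ 4 \<le> 2 ^ (d - 2)" by simp
    have "d ^ 2 \<le> d ^ 4" using d_ge by (intro power_increasing) auto
    moreover have "d ^ 1 \<le> d ^ 4" using d_ge by (intro power_increasing) auto
    ultimately have "4 * (d * d) + 2 * d \<le> 8 * d ^ 4" by (simp add: power2_eq_square)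
    then show ?thesis using 1 by linarith
  qed
  ultimately have "4 * (d * d) \<le> card ?S" unfolding cI by linarith
  then have "real (4 * (d * d)) \<le> real (card ?S)" by (simp only: of_nat_le_iff)
  then have "4 * real d * real d * (1 / real d) \<le> real (card ?S) * (1 / real d)"
    by (intro mult_right_mono) auto
  then have "4 * real d \<le> real (card ?S) * (1 / real d)" using d_ge by simp
  also have "\<dots> \<le> (\<Sum>A\<in>?S. 1 / real (card A))"
  proof (rule sum_bounded_below)
    fix A assume A: "A \<in> ?S"
    then have "A \<subseteq> B" using x0_only by blast
    then have "card A \<le> d" using finite_B card_B card_mono by metis
    moreover have "0 < card A" using A finite_member by (auto simp: card_gt_0_iff)
    ultimately show "1 / real d \<le> 1 / real (card A)" by (simp add: frac_le)
  qed
  finally show ?thesis .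
qed

text \<open>A missing pair would have codimension at least d - 2, far beyond d/8.\<close>

lemma pair_mem:
  assumes "y \<in> B" "z \<in> B"
  shows "{y, z} \<in> F"
proof (rule ccontr)
  assume "{y, z} \<notin> F"
  then have "{y, z} \<in> M" using assms by (auto simp: M_def)
  then have "8 * (d - card {y, z}) \<le> d" by (rule codim_M)
  moreover have "card {y, z} \<le> 2" by (simp add: card_insert_if)
  ultimately show False using d_ge by linarith
qed

end

section \<open>Tight points and the blocks they span\<close>

context dense_family
begin

definition tau :: real where "tau = (2 ^ d - real c) / real d"

definition nbhd :: "'a \<Rightarrow> 'a set" where "nbhd x = insert x (supp (link F x))"

definition tight :: "'a \<Rightarrow> bool" where "tight x \<longleftrightarrow> x \<in> V \<and> card (nbhd x) = d"

definition blocks :: "'a set set" where "blocks = nbhd ` {x. tight x}"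

definition mult :: "'a \<Rightarrow> nat" where "mult y = card {B \<in> blocks. y \<in> B}"

lemma supp_link_subset: "supp (link F x) \<subseteq> V - {x}"
  using link_subset_Pow[OF F_subset, of x] by (auto simp: supp_def)

lemma finite_supp_link: "finite (supp (link F x))"
  using supp_link_subset finite_V finite_subset by (metis finite_Diff)

lemma card_nbhd: "card (nbhd x) = Suc (card (supp (link F x)))"
  unfolding nbhd_def using supp_link_subset finite_supp_link by (intro card_insert_disjoint) blast+

lemma nbhd_iff: "x \<in> V \<Longrightarrow> y \<in> nbhd x \<longleftrightarrow> {x, y} \<in> F"
proof -
  assume x: "x \<in> V"
  have "{x} \<in> F"
  proof -
    have "d - 1 < 2 ^ (d - 1)" by (rule less_exp)
    then have "0 < card {A \<in> F. x \<in> A}" using degree[OF x] c_le by linarith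
    then obtain A where "A \<in> F" "x \<in> A" by (auto simp: card_gt_0_iff)
    then show ?thesis using F_D[of A "{x}"] by blast
  qed
  then show ?thesis unfolding nbhd_def supp_def link_def by (auto simp: insert_commute)
qed

lemma mem_nbhd: "A \<in> F \<Longrightarrow> x \<in> A \<Longrightarrow> A \<subseteq> nbhd x"
proof
  fix y assume A: "A \<in> F" "x \<in> A" "y \<in> A"
  then have "x \<in> V" "{x, y} \<in> F" using F_subset F_D[OF A(1), of "{x, y}"] by auto
  then show "y \<in> nbhd x" using nbhd_iff by blast
qed

lemma card_link_ge: "x \<in> V \<Longrightarrow> 2 ^ (d - 1) \<le> card (link F x) + (c - 1)"
  using degree[of x] c_ge unfolding card_link by linarith

lemma card_nbhd_ge:
  assumes "x \<in> V"
  shows "d \<le> card (nbhd x)"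
proof (rule ccontr)
  assume "\<not> ?thesis"
  then have s: "card (supp (link F x)) \<le> d - 2" using card_nbhd[of x] by linarith
  have "card (link F x) \<le> card (Pow (supp (link F x)))"
    using finite_supp_link subset_Pow_supp[OF hereditary_link[OF hered]] by (intro card_mono) auto
  also have "\<dots> = 2 ^ card (supp (link F x))" by (rule card_Pow[OF finite_supp_link])
  also have "\<dots> \<le> 2 ^ (d - 2)" using s by (intro power_increasing) auto
  finally have "2 ^ (d - 1) \<le> 2 ^ (d - 2) + (c - 1)" using card_link_ge[OF assms] by linarith
  moreover have "(2::nat) ^ (d - 1) = 2 * 2 ^ (d - 2)" by (rule two_power_d_minus_one)
  moreover have "16 * (d - 1 + 1) ^ 4 \<le> (2::nat) ^ (d - 1)" using d_ge by (intro two_power_ge) auto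
  moreover have "d ^ 1 \<le> d ^ 4" using d_ge by (intro power_increasing) auto
  moreover have "d - 1 + 1 = d" using d_ge by simp
  ultimately show False using c_le d_ge by simp
qed

lemma tau_eq: "cube_mass (d - 1) - real (c - 1) / real d = tau"
  using d_ge c_ge by (simp add: cube_mass_def tau_def of_nat_diff diff_divide_distrib)

lemma weight_ge_tau:
  assumes "x \<in> V" "\<not> tight x"
  shows "tau \<le> weight x"
proof -
  have "card (nbhd x) \<noteq> d" using assms by (simp add: tight_def)
  then have "d - 1 + 1 \<le> card (supp (link F x))" using card_nbhd_ge[OF assms(1)] card_nbhd[of x] d_ge by linarith
  then have "cube_mass (d - 1) - real (c - 1) / (real (d - 1) + 1) \<le> mass 1 (link F x)"
    using d_ge c_le card_link_ge[OF assms(1)]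
    by (intro mass_ge_large_support hereditary_link hered finite_supp_link) auto
  moreover have "real (d - 1) + 1 = real d" using d_ge by simp
  ultimately show ?thesis using tau_eq weight_eq_mass by simp
qed

text \<open>The link of a tight point is close to a cube and falls short by at most 3/20; the
  rounded loss 1 is what \<open>card_ge\<close> charges per tight point.\<close>

lemma weight_ge_tau_minus_one:
  assumes "x \<in> V"
  shows "tau - 1 \<le> weight x"
proof (cases "tight x")
  case False
  then show ?thesis using weight_ge_tau[OF assms] by simp
next
  case True
  then have s: "card (supp (link F x)) = d - 1" using card_nbhd[of x] by (auto simp: tight_def)
  define q where "q = 2 ^ (d - 1) - card (link F x)"
  have "card (link F x) \<le> card (Pow (supp (link F x)))"
    using finite_supp_link subset_Pow_supp[OF hereditary_link[OF hered]] by (intro card_mono) auto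
  then have le: "card (link F x) \<le> 2 ^ (d - 1)" using card_Pow[OF finite_supp_link, of x] s by simp
  have q: "q \<le> c - 1" using card_link_ge[OF assms] by (simp add: q_def)
  have "cube_mass (d - 1) - real q / (real (d - 1) + 1) - 3 / 20 \<le> mass 1 (link F x)"
    using d_ge c_le q le s
    by (intro mass_ge_near_cube hereditary_link hered finite_supp_link) (auto simp: q_def)
  moreover have "real (d - 1) + 1 = real d" using d_ge by simp
  moreover have "real q / real d \<le> real (c - 1) / real d" using q by (intro divide_right_mono) auto
  ultimately show ?thesis using tau_eq weight_eq_mass by simp
qed

lemma block_nbhd: "tight x \<Longrightarrow> block V F d c (nbhd x) x"
proof unfold_locales
  assume x: "tight x"
  then have xV: "x \<in> V" by (simp add: tight_def)
  show "nbhd x \<subseteq> V" using xV supp_link_subset by (auto simp: nbhd_def)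
  show "card (nbhd x) = d" using x by (simp add: tight_def)
  show "x \<in> nbhd x" by (simp add: nbhd_def)
  show "\<And>A. A \<in> F \<Longrightarrow> x \<in> A \<Longrightarrow> A \<subseteq> nbhd x" by (rule mem_nbhd)
qed

text \<open>All pairs inside a block are members, so \<open>nbhd x\<close> is contained in
  \<open>nbhd y\<close>, and both have d points. Consequently a tight point lies in one block
  only.\<close>

lemma nbhd_eq:
  assumes "tight x" "tight y" "y \<in> nbhd x"
  shows "nbhd y = nbhd x"
proof -
  interpret block V F d c "nbhd x" x by (rule block_nbhd[OF assms(1)])
  have "nbhd x \<subseteq> nbhd y"
  proof
    fix z assume "z \<in> nbhd x"
    then show "z \<in> nbhd y" using pair_mem[OF assms(3)] nbhd_iff[of y z] assms(2) by (simp add: tight_def)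
  qed
  moreover have "finite (nbhd y)" using finite_supp_link by (simp add: nbhd_def)
  ultimately show ?thesis using assms(1,2) card_subset_eq[of "nbhd y" "nbhd x"] by (simp add: tight_def)
qed

lemma finite_blocks: "finite blocks"
proof -
  have "{x. tight x} \<subseteq> V" by (auto simp: tight_def)
  then show ?thesis unfolding blocks_def using finite_V finite_subset by blast
qed

text \<open>One block through y supplies \<open>tau\<close> - 2d. Every other block B supplies 4d
  from the sets through y and its tight point \<open>z B\<close>; these collections are disjoint
  because a tight point lies in one block only. Finally 4(m - 1) - 2 >= m for m >= 2.\<close>

lemma weight_multiple:
  assumes y: "2 \<le> mult y"
  shows "tau + real (mult y) * real d \<le> weight y"
proof -
  define Q where "Q = {B \<in> blocks. y \<in> B}"
  have fQ: "finite Q" using finite_blocks by (simp add: Q_def)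
  have cQ: "card Q = mult y" by (simp add: Q_def mult_def)
  have "\<forall>B\<in>blocks. \<exists>z. tight z \<and> nbhd z = B" by (auto simp: blocks_def)
  then obtain z where z: "\<And>B. B \<in> blocks \<Longrightarrow> tight (z B) \<and> nbhd (z B) = B" by metis
  have zz: "B = B'" if "B \<in> blocks" "B' \<in> blocks" "z B' \<in> B" for B B'
    using nbhd_eq[of "z B" "z B'"] z that by metis
  have "Q \<noteq> {}" using y cQ by auto
  then obtain B1 where B1: "B1 \<in> Q" by blast
  then have B1b: "B1 \<in> blocks" "y \<in> B1" by (auto simp: Q_def)
  define S where "S B = {A \<in> F. y \<in> A \<and> z B \<in> A}" for B
  let ?A0 = "{A \<in> F. A \<subseteq> B1 \<and> y \<in> A}"
  let ?w = "\<lambda>A. 1 / real (card A)"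
  have SB: "A \<subseteq> B" if "A \<in> S B" "B \<in> blocks" for A B
    using that mem_nbhd[of A "z B"] z by (auto simp: S_def)
  have fS: "finite (S B)" for B unfolding S_def using finite_F by simp
  have Sge: "4 * real d \<le> sum ?w (S B)" if B: "B \<in> Q - {B1}" for B
  proof -
    have Bb: "B \<in> blocks" "y \<in> B" "B \<noteq> B1" using B by (auto simp: Q_def)
    interpret block V F d c "nbhd (z B)" "z B" using block_nbhd z[OF Bb(1)] by blast
    have "y \<noteq> z B" using zz[OF B1b(1) Bb(1)] B1b(2) Bb(3) by blast
    then show ?thesis using weight_through_ge[of y] Bb z[OF Bb(1)] by (simp add: S_def)
  qed
  have A0: "tau - 2 * real d \<le> sum ?w ?A0"
  proof -
    interpret block V F d c "nbhd (z B1)" "z B1" using block_nbhd z[OF B1b(1)] by blast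
    show ?thesis using weight_inside_ge[of y] B1b z[OF B1b(1)] by (simp add: tau_def)
  qed
  have U: "sum ?w (\<Union>B\<in>Q - {B1}. S B) = (\<Sum>B\<in>Q - {B1}. sum ?w (S B))"
  proof (rule sum.UNION_disjoint)
    show "\<forall>B\<in>Q - {B1}. \<forall>B'\<in>Q - {B1}. B \<noteq> B' \<longrightarrow> S B \<inter> S B' = {}"
    proof (intro ballI impI, rule ccontr)
      fix B B' assume B: "B \<in> Q - {B1}" "B' \<in> Q - {B1}" "B \<noteq> B'" "S B \<inter> S B' \<noteq> {}"
      then obtain A where A: "A \<in> S B" "A \<in> S B'" by blast
      have b: "B \<in> blocks" "B' \<in> blocks" using B by (auto simp: Q_def)
      have "z B' \<in> B" using SB[OF A(1) b(1)] A(2) by (auto simp: S_def)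
      then show False using zz[OF b] B(3) by blast
    qed
  qed (use fQ fS in auto)
  have dis: "?A0 \<inter> (\<Union>B\<in>Q - {B1}. S B) = {}"
  proof (rule ccontr)
    assume "\<not> ?thesis"
    then obtain A B where A: "A \<subseteq> B1" "A \<in> S B" "B \<in> Q" "B \<noteq> B1" by blast
    have "z B \<in> B1" using A by (auto simp: S_def)
    then show False using zz[OF B1b(1), of B] A by (auto simp: Q_def)
  qed
  have "4 * real d * (real (mult y) - 1) = (\<Sum>B\<in>Q - {B1}. 4 * real d)"
    using B1 fQ cQ y by (simp add: of_nat_diff)
  also have "\<dots> \<le> (\<Sum>B\<in>Q - {B1}. sum ?w (S B))" by (rule sum_mono[OF Sge])
  finally have "tau - 2 * real d + 4 * real d * (real (mult y) - 1) \<le> sum ?w ?A0 + sum ?w (\<Union>B\<in>Q - {B1}. S B)"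
    using A0 U by linarith
  also have "\<dots> = sum ?w (?A0 \<union> (\<Union>B\<in>Q - {B1}. S B))"
    using dis fQ fS finite_F by (intro sum.union_disjoint[symmetric]) auto
  also have "\<dots> \<le> weight y"
    unfolding weight_def using finite_F by (intro sum_mono2) (auto simp: S_def)
  finally have *: "tau - 2 * real d + 4 * real d * (real (mult y) - 1) \<le> weight y" .
  have "real d * 2 \<le> real d * real (mult y)" using y by (intro mult_left_mono) auto
  then show ?thesis using * by (simp add: algebra_simps)
qed

lemma sum_weight: "V \<noteq> {} \<Longrightarrow> (\<Sum>x\<in>V. weight x) = real (card F) - 1"
proof -
  assume V: "V \<noteq> {}"
  have "(\<Sum>x\<in>V. weight x) = (\<Sum>A\<in>F. \<Sum>x\<in>{x \<in> V. x \<in> A}. 1 / real (card A))"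
    unfolding weight_def
    using sum.swap_restrict[OF finite_V finite_F, of "\<lambda>_ A. 1 / real (card A)" "\<lambda>x A. x \<in> A"] by simp
  also have "\<dots> = (\<Sum>A\<in>F. if A = {} then 0 else 1)"
  proof (rule sum.cong)
    fix A assume A: "A \<in> F"
    then have "{x \<in> V. x \<in> A} = A" using F_subset by blast
    then show "(\<Sum>x\<in>{x \<in> V. x \<in> A}. 1 / real (card A)) = (if A = {} then 0 else 1)"
      using A finite_member by auto
  qed simp
  also have "\<dots> = (\<Sum>A\<in>F - {{}}. 1)"
    using finite_F by (intro sum.mono_neutral_cong_right) auto
  also have "\<dots> = real (card F) - 1"
  proof -
    have "card F = Suc (card (F - {{}}))" using finite_F empty_mem[OF V] by (rule card.remove)
    then show ?thesis by simp
  qed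
  finally show ?thesis .
qed

text \<open>The blocks in L share no point with another block; they are disjoint, number at most
  \<open>card V\<close> / d and lose at most 1/2 each. Every other block has a point in P, and a
  point y of P has surplus d for each of the \<open>mult y\<close> blocks through it, enough for a
  loss of at most 1 at each tight point of the block. The final 1 counts the empty set.\<close>

lemma card_ge:
  assumes V: "V \<noteq> {}"
  shows "real (card V) * (tau - (if c = d then 1 / 2 else 0) / real d) + 1 \<le> real (card F)"
proof -
  let ?e = "if c = d then 1 / 2 else 0 :: real"
  let ?f = "\<lambda>x. weight x - tau"
  define L where "L = {B \<in> blocks. \<forall>y\<in>B. mult y = 1}"
  define R where "R = V - \<Union>L"
  define P where "P = {y \<in> R. 2 \<le> mult y}"
  define K where "K = blocks - L"
  have fL: "finite L" "finite K" using finite_blocks by (auto simp: L_def K_def)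
  have bV: "B \<subseteq> V" "card B = d" "finite B" if "B \<in> blocks" for B
    using that supp_link_subset finite_supp_link by (auto simp: blocks_def nbhd_def tight_def)
  have fR: "finite R" "finite P" using finite_V by (auto simp: R_def P_def)
  have uniq: "B = B'" if "B \<in> L" "B' \<in> blocks" "y \<in> B" "y \<in> B'" for B B' y
  proof -
    have "mult y = 1" using that(1,3) by (simp add: L_def)
    then have "card {B \<in> blocks. y \<in> B} = 1" by (simp only: mult_def)
    then obtain B0 where B0: "{B \<in> blocks. y \<in> B} = {B0}" by (rule card_1_singletonE)
    have "B \<in> {B \<in> blocks. y \<in> B}" "B' \<in> {B \<in> blocks. y \<in> B}" using that by (simp_all add: L_def)
    then show ?thesis unfolding B0 by simp
  qed
  have dis: "\<forall>B\<in>L. \<forall>B'\<in>L. B \<noteq> B' \<longrightarrow> B \<inter> B' = {}"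
  proof (intro ballI impI, rule ccontr)
    fix B B' assume B: "B \<in> L" "B' \<in> L" "B \<noteq> B'" "B \<inter> B' \<noteq> {}"
    then obtain y where y: "y \<in> B" "y \<in> B'" by blast
    have "B' \<in> blocks" using B(2) by (simp add: L_def)
    then show False using uniq[OF B(1) _ y] B(3) by blast
  qed
  have LV: "\<Union>L \<subseteq> V" using bV by (auto simp: L_def)
  have "card (\<Union>L) = (\<Sum>B\<in>L. card B)"
    using dis bV by (intro card_Union_disjoint) (auto simp: L_def pairwise_def disjnt_def)
  also have "\<dots> = card L * d" using bV by (simp add: L_def)
  finally have "card L * d \<le> card V" using card_mono[OF finite_V LV] by simp
  then have "real (card L) * real d \<le> real (card V)" by (metis of_nat_le_iff of_nat_mult)
  then have cL: "real (card L) \<le> real (card V) / real d" using d_ge by (simp add: le_divide_eq)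
  have bf: "- ?e \<le> sum ?f B" if "B \<in> blocks" for B
  proof -
    obtain x where x: "tight x" "nbhd x = B" using \<open>B \<in> blocks\<close> by (auto simp: blocks_def)
    interpret block V F d c B x using block_nbhd[OF x(1)] x(2) by simp
    have "sum ?f B = (\<Sum>v\<in>B. weight v) - real d * tau" by (simp add: sum_subtractf card_B)
    also have "real d * tau = 2 ^ d - real c" using d_ge by (simp add: tau_def)
    finally show ?thesis using sum_weight_block_ge by linarith
  qed
  have "- ?e * (real (card V) / real d) \<le> - ?e * real (card L)" using cL by (simp add: mult_left_mono_neg)
  also have "\<dots> = (\<Sum>B\<in>L. - ?e)" by simp
  also have "\<dots> \<le> (\<Sum>B\<in>L. sum ?f B)" using bf by (intro sum_mono) (auto simp: L_def)
  also have "\<dots> = sum ?f (\<Union>L)"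
    using sum.UNION_disjoint[of L "\<lambda>B. B" ?f] fL dis bV by (simp add: L_def)
  finally have partL: "- ?e * (real (card V) / real d) \<le> sum ?f (\<Union>L)" .
  have partR: "0 \<le> sum ?f R"
  proof -
    have "card K \<le> (\<Sum>B\<in>K. card {y \<in> P. y \<in> B})"
    proof -
      have "1 \<le> card {y \<in> P. y \<in> B}" if B: "B \<in> K" for B
      proof -
        obtain y where y: "y \<in> B" "mult y \<noteq> 1" using B by (auto simp: K_def L_def)
        have "0 < mult y" unfolding mult_def using B y finite_blocks by (auto simp: card_gt_0_iff K_def)
        moreover have "y \<in> R" using y bV B by (auto simp: R_def L_def K_def)
        ultimately have "y \<in> {y \<in> P. y \<in> B}" using y by (auto simp: P_def)
        then show ?thesis using fR by (auto simp: Suc_le_eq card_gt_0_iff)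
      qed
      then have "(\<Sum>B\<in>K. 1) \<le> (\<Sum>B\<in>K. card {y \<in> P. y \<in> B})" by (rule sum_mono)
      then show ?thesis by simp
    qed
    also have "\<dots> = (\<Sum>y\<in>P. card {B \<in> K. y \<in> B})"
      using sum.swap_restrict[OF fL(2) fR(2), of "\<lambda>_ _. 1::nat" "\<lambda>B y. y \<in> B"] by simp
    also have "\<dots> \<le> (\<Sum>y\<in>P. mult y)"
      unfolding mult_def K_def using finite_blocks by (intro sum_mono card_mono) auto
    finally have "real (card K) \<le> (\<Sum>y\<in>P. real (mult y))" by (metis of_nat_le_iff of_nat_sum)
    then have "real (card K) * real d \<le> (\<Sum>y\<in>P. real (mult y)) * real d" by (rule mult_right_mono) simp
    also have "\<dots> = (\<Sum>y\<in>P. real (mult y) * real d)" by (rule sum_distrib_right)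
    also have "\<dots> \<le> sum ?f P" using weight_multiple by (intro sum_mono) (force simp: P_def)
    finally have 1: "real (card K) * real d \<le> sum ?f P" .
    let ?T = "{x \<in> R - P. tight x}"
    have "?T \<subseteq> \<Union>K"
    proof
      fix x assume x: "x \<in> ?T"
      then have "nbhd x \<in> blocks" "x \<in> nbhd x" by (auto simp: blocks_def nbhd_def)
      moreover have "nbhd x \<notin> L" using x by (auto simp: R_def nbhd_def)
      ultimately show "x \<in> \<Union>K" by (auto simp: K_def)
    qed
    moreover have "finite (\<Union>K)" using fL bV by (auto simp: K_def)
    ultimately have "card ?T \<le> card (\<Union>K)" by (rule card_mono[rotated])
    also have "\<dots> \<le> (\<Sum>B\<in>K. card B)" by (rule card_Union_le_sum_card)
    also have "\<dots> = card K * d" using bV by (simp add: K_def)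
    finally have "real (card ?T) \<le> real (card K) * real d" by (metis of_nat_le_iff of_nat_mult)
    moreover have "- real (card ?T) \<le> sum ?f (R - P)"
    proof -
      have "- real (card ?T) = (\<Sum>x\<in>?T. - 1)" by simp
      also have "\<dots> = (\<Sum>x\<in>R - P. if tight x then - 1 else 0)"
        using fR by (simp add: sum.If_cases Int_def)
      also have "\<dots> \<le> sum ?f (R - P)"
      proof (rule sum_mono)
        fix x assume "x \<in> R - P"
        then have "x \<in> V" by (simp add: R_def)
        then show "(if tight x then - 1 else 0) \<le> ?f x"
          using weight_ge_tau[of x] weight_ge_tau_minus_one[of x] by simp
      qed
      finally show ?thesis .
    qed
    moreover have "sum ?f R = sum ?f P + sum ?f (R - P)"
      using fR by (subst sum.subset_diff[of P R]) (auto simp: P_def)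
    ultimately show ?thesis using 1 by linarith
  qed
  have "sum ?f V = sum ?f R + sum ?f (\<Union>L)"
    unfolding R_def by (rule sum.subset_diff[OF LV finite_V])
  then have "- ?e * (real (card V) / real d) \<le> sum ?f V" using partL partR by linarith
  also have "sum ?f V = real (card F) - 1 - real (card V) * tau"
    using sum_weight[OF V] by (simp add: sum_subtractf)
  finally show ?thesis by (simp add: algebra_simps)
qed

end

section \<open>Compression and the function m(n,s)\<close>

text \<open>The down-shift at x: x is dropped from every member where this gives a set not already
  in the family.\<close>

definition compress :: "nat \<Rightarrow> nat set set \<Rightarrow> nat set set" where
  "compress x F = {A. x \<notin> A \<and> (A \<in> F \<or> insert x A \<in> F)} \<union> {A. x \<in> A \<and> A \<in> F \<and> A - {x} \<in> F}"

lemma compress_subset_Pow: "F \<subseteq> Pow V \<Longrightarrow> compress x F \<subseteq> Pow V"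
  unfolding compress_def by blast

lemma del_compress: "del (compress x F) x = del F x \<union> link F x"
  by (auto simp: del_def link_def compress_def)

lemma link_compress: "link (compress x F) x = del F x \<inter> link F x"
  by (auto simp: del_def link_def compress_def)

text \<open>Against \<open>sum_link_split\<close>, only the part \<open>link F x - del F x\<close>
  changes: f is evaluated at A instead of \<open>insert x A\<close>. A constant f gives the size,
  and f = card the decrease that makes repeated compression terminate.\<close>

lemma sum_compress:
  fixes f :: "nat set \<Rightarrow> nat"
  assumes "finite V" "F \<subseteq> Pow V"
  shows "(\<Sum>A\<in>compress x F. f A)
    = (\<Sum>A\<in>del F x. f A) + (\<Sum>A\<in>link F x - del F x. f A) + (\<Sum>A\<in>del F x \<inter> link F x. f (insert x A))"
proof -
  have fP: "finite (Pow V)" using assms(1) by simp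
  note fF = finite_subset[OF assms(2) fP] and fC = finite_subset[OF compress_subset_Pow[OF assms(2), of x] fP]
  have "(\<Sum>A\<in>del F x \<union> link F x. f A) = (\<Sum>A\<in>del F x \<union> (link F x - del F x). f A)"
    by (rule arg_cong[of _ _ "sum f"]) blast
  also have "\<dots> = (\<Sum>A\<in>del F x. f A) + (\<Sum>A\<in>link F x - del F x. f A)"
    using finite_del[OF fF] finite_link[OF fF] by (intro sum.union_disjoint) auto
  finally show ?thesis unfolding sum_del_link[OF fC, of f x] del_compress link_compress by simp
qed

lemma sum_link_split:
  fixes f :: "nat set \<Rightarrow> nat"
  assumes "finite F"
  shows "(\<Sum>A\<in>F. f A)
    = (\<Sum>A\<in>del F x. f A) + (\<Sum>A\<in>link F x - del F x. f (insert x A)) + (\<Sum>A\<in>del F x \<inter> link F x. f (insert x A))"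
proof -
  have "(\<Sum>A\<in>link F x. f (insert x A))
      = (\<Sum>A\<in>(link F x - del F x) \<union> (del F x \<inter> link F x). f (insert x A))"
    by (rule arg_cong[of _ _ "sum (\<lambda>A. f (insert x A))"]) blast
  also have "\<dots> = (\<Sum>A\<in>link F x - del F x. f (insert x A)) + (\<Sum>A\<in>del F x \<inter> link F x. f (insert x A))"
    using finite_del[OF assms] finite_link[OF assms] by (intro sum.union_disjoint) auto
  finally show ?thesis unfolding sum_del_link[OF assms, of f x] by simp
qed

lemma card_compress:
  assumes "finite V" "F \<subseteq> Pow V"
  shows "card (compress x F) = card F"
proof -
  have "finite F" using assms finite_subset by blast
  then show ?thesis
    using sum_compress[OF assms, of "\<lambda>_. 1" x] sum_link_split[of F "\<lambda>_. 1" x] by (simp only: card_eq_sum)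
qed

lemma sum_card_compress_less:
  assumes "finite V" "F \<subseteq> Pow V" "A \<in> F" "x \<in> A" "A - {x} \<notin> F"
  shows "(\<Sum>A\<in>compress x F. card A) < (\<Sum>A\<in>F. card A)"
proof -
  have fF: "finite F" using assms finite_subset by blast
  have "A - {x} \<in> link F x - del F x"
    using assms(3-5) by (auto simp: link_def del_def insert_absorb)
  moreover have "finite (link F x - del F x)" using finite_link[OF fF] by simp
  moreover have "card C < card (insert x C)" if "C \<in> link F x" for C
    using card_insert_link[OF assms(1,2) that] by simp
  ultimately have "(\<Sum>A\<in>link F x - del F x. card A) < (\<Sum>A\<in>link F x - del F x. card (insert x A))"
    by (intro sum_strict_mono) auto
  then show ?thesis
    unfolding sum_compress[OF assms(1,2)] sum_link_split[OF fF, of card x] by simp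
qed

lemma trace_compress_subset:
  "x \<in> T \<Longrightarrow> trace (compress x F) T \<subseteq> compress x (trace F T)"
  "x \<notin> T \<Longrightarrow> trace (compress x F) T \<subseteq> trace F T"
proof -
  have mem: "A \<in> F \<Longrightarrow> A \<inter> T \<in> trace F T" for A by (auto simp: trace_def)
  show "trace (compress x F) T \<subseteq> compress x (trace F T)" if x: "x \<in> T"
  proof
    fix C assume "C \<in> trace (compress x F) T"
    then obtain A where A: "A \<in> compress x F" "C = A \<inter> T" by (auto simp: trace_def)
    have "insert x A \<inter> T = insert x (A \<inter> T)" "(A - {x}) \<inter> T = (A \<inter> T) - {x}" using x by auto
    then show "C \<in> compress x (trace F T)"
      using A x mem[of A] mem[of "insert x A"] mem[of "A - {x}"] by (auto simp: compress_def)
  qed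
  show "trace (compress x F) T \<subseteq> trace F T" if x: "x \<notin> T"
  proof
    fix C assume "C \<in> trace (compress x F) T"
    then obtain A where A: "A \<in> compress x F" "C = A \<inter> T" by (auto simp: trace_def)
    have "insert x A \<inter> T = A \<inter> T" using x by auto
    then show "C \<in> trace F T"
      using A mem[of A] mem[of "insert x A"] by (auto simp: compress_def)
  qed
qed

text \<open>If x lies in T, the trace of the compressed family lies in the compressed trace, which
  is as large as the original trace; otherwise dropping x is invisible on T.\<close>

lemma card_trace_compress_le:
  assumes "finite V" "F \<subseteq> Pow V" "T \<subseteq> V"
  shows "card (trace (compress x F) T) \<le> card (trace F T)"
proof -
  have T: "finite T" "trace F T \<subseteq> Pow T" "finite (trace F T)"
    using assms finite_subset by (auto simp: trace_def) blast+
  have "finite (compress x (trace F T))"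
    using compress_subset_Pow[OF T(2), of x] T(1) finite_subset by blast
  then show ?thesis
    using trace_compress_subset[of x T F] card_mono[of "compress x (trace F T)"] card_mono[OF T(3)]
      card_compress[OF T(1,2), of x] by (cases "x \<in> T") auto
qed

lemma hereditary_if_remove_one:
  assumes "finite V" "F \<subseteq> Pow V" "\<And>A x. A \<in> F \<Longrightarrow> x \<in> A \<Longrightarrow> A - {x} \<in> F"
  shows "hereditary F"
  unfolding hereditary_def
proof (intro ballI allI impI)
  fix A B assume A: "A \<in> F" "B \<subseteq> A"
  have *: "finite C \<Longrightarrow> A - C \<in> F" for C
  proof (induction C rule: finite_induct)
    case (insert x C)
    have "A - insert x C = (A - C) - {x}" by blast
    then show ?case using assms(3)[OF insert.IH, of x] insert.IH by (cases "x \<in> A - C") auto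
  qed (use A in simp)
  have "finite A" using A assms(1,2) finite_subset by blast
  then have "A - (A - B) \<in> F" using *[of "A - B"] by simp
  then show "B \<in> F" using A(2) by (simp add: double_diff)
qed

text \<open>A compression that changes the family lowers the sum of the cardinalities, and a family
  fixed by all compressions is hereditary.\<close>

lemma exists_hereditary_smaller_traces:
  assumes "finite V" "F \<subseteq> Pow V"
  shows "\<exists>G. hereditary G \<and> G \<subseteq> Pow V \<and> card G = card F
    \<and> (\<forall>T\<subseteq>V. card (trace G T) \<le> card (trace F T))"
  using assms(2)
proof (induction "\<Sum>A\<in>F. card A" arbitrary: F rule: less_induct)
  case less
  show ?case
  proof (cases "\<forall>A x. A \<in> F \<longrightarrow> x \<in> A \<longrightarrow> A - {x} \<in> F")
    case True
    then show ?thesis using hereditary_if_remove_one[OF assms(1) less.prems] less.prems by blast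
  next
    case False
    then obtain A x where A: "A \<in> F" "x \<in> A" "A - {x} \<notin> F" by blast
    obtain G where G: "hereditary G" "G \<subseteq> Pow V" "card G = card (compress x F)"
      "\<forall>T\<subseteq>V. card (trace G T) \<le> card (trace (compress x F) T)"
      using less.hyps[OF sum_card_compress_less[OF assms(1) less.prems A] compress_subset_Pow[OF less.prems]] by blast
    have "\<forall>T\<subseteq>V. card (trace G T) \<le> card (trace F T)"
      using G(4) card_trace_compress_le[OF assms(1) less.prems] le_trans by blast
    then show ?thesis using G card_compress[OF assms(1) less.prems] by auto
  qed
qed

lemma card_trace_hereditary:
  assumes "finite V" "F \<subseteq> Pow V" "hereditary F"
  shows "card (trace F (V - {x})) + card {A \<in> F. x \<in> A} = card F"
proof -
  have "trace F (V - {x}) = del F x"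
  proof
    show "trace F (V - {x}) \<subseteq> del F x"
      using assms(3) by (auto simp: trace_def del_def elim!: hereditaryD)
    show "del F x \<subseteq> trace F (V - {x})"
    proof
      fix A assume A: "A \<in> del F x"
      then have "A = A \<inter> (V - {x})" using assms(2) by (auto simp: del_def)
      then show "A \<in> trace F (V - {x})" using A by (auto simp: trace_def del_def)
    qed
  qed
  then show ?thesis
    using card_del_link[of F x] finite_subset[OF assms(2)] assms(1) by (simp add: card_link)
qed

section \<open>Hereditary families and the arrow relation\<close>

definition feasible :: "nat \<Rightarrow> nat set \<Rightarrow> nat set set \<Rightarrow> bool" where
  "feasible s V F \<longleftrightarrow> F \<subseteq> Pow V \<and> hereditary F \<and> (\<forall>x\<in>V. s < card {A \<in> F. x \<in> A})"

lemma arrow_if_feasible_large: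
  assumes n: "1 \<le> n"
    and large: "\<And>V F. finite V \<Longrightarrow> card V = n \<Longrightarrow> feasible s V F \<Longrightarrow> m < card F"
  shows "arrow n m (n - 1) (m - s)"
  unfolding arrow_def
proof (intro allI impI, elim conjE)
  fix V :: "nat set" and F assume V: "finite V" "card V = n" and F: "F \<subseteq> Pow V" "m \<le> card F"
  have fF: "finite F" using V F finite_subset by blast
  \<comment> \<open>Passing to exactly m sets only lowers traces, and fixes the size at which the
    compressed family cannot be feasible.\<close>
  obtain F' where F': "F' \<subseteq> F" "card F' = m" using F(2) by (metis obtain_subset_with_card_n)
  have F'V: "F' \<subseteq> Pow V" using F' F by blast
  obtain G where G: "hereditary G" "G \<subseteq> Pow V" "card G = m"
    "\<And>T. T \<subseteq> V \<Longrightarrow> card (trace G T) \<le> card (trace F' T)"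
    using exists_hereditary_smaller_traces[OF V(1) F'V] F'(2) by auto
  have "\<not> feasible s V G" using large[OF V, of G] G(3) by blast
  then obtain x where x: "x \<in> V" "card {A \<in> G. x \<in> A} \<le> s"
    using G by (auto simp: feasible_def not_less)
  have "m - s \<le> card (trace G (V - {x}))"
    using card_trace_hereditary[OF V(1) G(2,1), of x] x(2) G(3) by linarith
  also have "\<dots> \<le> card (trace F' (V - {x}))" by (rule G(4)) blast
  also have "\<dots> \<le> card (trace F (V - {x}))"
    using F' fF by (intro card_mono) (auto simp: trace_def)
  finally show "\<exists>T\<subseteq>V. card T = n - 1 \<and> m - s \<le> card (trace F T)"
    using x(1) V by (intro exI[of _ "V - {x}"]) auto
qed

text \<open>Because \<open>mfun\<close> is a greatest value, the arrow has to fail for every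
  admissible m from \<open>card F\<close> on. Enlarging F inside the cube to a hereditary family of
  exactly m sets only raises degrees, so deleting any point still loses more than s.\<close>

lemma not_arrow_if_feasible:
  assumes n: "1 \<le> n" and V: "finite V" "card V = n" and F: "feasible s V F"
    and m: "card F \<le> m" "m \<le> 2 ^ n"
  shows "\<not> arrow n m (n - 1) (m - s)"
proof
  assume arr: "arrow n m (n - 1) (m - s)"
  have F': "F \<subseteq> Pow V" "hereditary F" "\<And>x. x \<in> V \<Longrightarrow> s < card {A \<in> F. x \<in> A}"
    using F by (auto simp: feasible_def)
  have "hereditary (Pow V)" by (auto simp: hereditary_def)
  then obtain G where G: "hereditary G" "F \<subseteq> G" "G \<subseteq> Pow V" "card G = m"
    using hereditary_between[OF F'(2,1) m(1)] m(2) V by (auto simp: card_Pow)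
  have fG: "finite G" using G(3) V finite_subset by blast
  obtain T where T: "T \<subseteq> V" "card T = n - 1" "m - s \<le> card (trace G T)"
    using arr[unfolded arrow_def, rule_format, of V G] V G(3,4) by auto
  have "card (V - T) = 1" using T V n card_Diff_subset[of T V] finite_subset by fastforce
  then obtain x where "V - T = {x}" by (auto simp: card_1_singleton_iff)
  then have x: "x \<in> V" "T = V - {x}" using T(1) by auto
  have "s < card {A \<in> F. x \<in> A}" by (rule F'(3)[OF x(1)])
  also have "\<dots> \<le> card {A \<in> G. x \<in> A}" using G(2) fG by (intro card_mono) auto
  finally show False
    using card_trace_hereditary[OF V(1) G(3,1), of x] T(3)[unfolded x(2)] G(4) by linarith
qed

lemma mfun_bounds:
  assumes n: "1 \<le> n"
    and large: "\<And>V F. finite V \<Longrightarrow> card V = n \<Longrightarrow> feasible s V F \<Longrightarrow> m < card F"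
    and V: "finite V" "card V = n" and F: "feasible s V F"
  shows "m \<le> mfun n s" "mfun n s < card F"
proof -
  let ?P = "\<lambda>m. m \<le> 2 ^ n \<and> arrow n m (n - 1) (m - s)"
  \<comment> \<open>Through a feasible family, \<open>m < card F\<close> also yields the side
    condition \<open>m \<le> 2 ^ n\<close> of \<open>mfun\<close>.\<close>
  have "card F \<le> 2 ^ n"
    using F V card_mono[of "Pow V" F] by (auto simp: feasible_def card_Pow)
  then have "?P m" using large[OF V F] arrow_if_feasible_large[OF n large] by simp
  moreover have bd: "\<And>y. ?P y \<Longrightarrow> y \<le> 2 ^ n" by blast
  ultimately show "m \<le> mfun n s" unfolding mfun_def by (rule Greatest_le_nat)
  have "?P (mfun n s)" unfolding mfun_def by (rule GreatestI_nat[of ?P m]) (use \<open>?P m\<close> in auto)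
  then show "mfun n s < card F" using not_arrow_if_feasible[OF n V F, of "mfun n s"] by (meson not_le)
qed

text \<open>The ground sets may overlap, as they do in \<open>feasible_cover\<close>; degrees only
  grow, and the common empty set accounts for the 1.\<close>

lemma feasible_Un:
  assumes "finite V" "finite W" "feasible s V F" "feasible s W G" "{} \<in> F" "{} \<in> G"
  shows "feasible s (V \<union> W) (F \<union> G)" "card (F \<union> G) + 1 \<le> card F + card G"
proof -
  have "F \<subseteq> Pow V" "G \<subseteq> Pow W" using assms by (simp_all add: feasible_def)
  then have fin: "finite F" "finite G" using assms(1,2) by (meson finite_Pow_iff finite_subset)+
  show "feasible s (V \<union> W) (F \<union> G)"
    unfolding feasible_def
  proof (intro conjI ballI)
    show "F \<union> G \<subseteq> Pow (V \<union> W)" using assms by (auto simp: feasible_def)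
    show "hereditary (F \<union> G)" using assms(3,4) by (auto simp: feasible_def hereditary_def)
    fix x assume x: "x \<in> V \<union> W"
    have "card {A \<in> F. x \<in> A} \<le> card {A \<in> F \<union> G. x \<in> A}" "card {A \<in> G. x \<in> A} \<le> card {A \<in> F \<union> G. x \<in> A}"
      using fin by (auto intro!: card_mono)
    then show "s < card {A \<in> F \<union> G. x \<in> A}"
      using x assms(3,4) by (auto simp: feasible_def intro: less_le_trans)
  qed
  have "{{}} \<subseteq> F \<inter> G" using assms by auto
  then have "card {{} :: nat set} \<le> card (F \<inter> G)" using fin by (intro card_mono) auto
  then show "card (F \<union> G) + 1 \<le> card F + card G" using card_Un_Int[OF fin] by simp
qed

lemma feasible_tiling:
  assumes block: "\<And>V :: nat set. finite V \<Longrightarrow> card V = g \<Longrightarrow> \<exists>F. feasible s V F \<and> {} \<in> F \<and> card F \<le> b + 1"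
  shows "finite V \<Longrightarrow> card V = k * g \<Longrightarrow> \<exists>F. feasible s V F \<and> {} \<in> F \<and> card F \<le> k * b + 1"
proof (induction k arbitrary: V)
  case 0
  then show ?case by (intro exI[of _ "{{}}"]) (auto simp: feasible_def hereditary_def)
next
  case (Suc k)
  obtain W where W: "W \<subseteq> V" "card W = g" using Suc.prems by (metis le_add1 mult_Suc obtain_subset_with_card_n)
  have fW: "finite W" "finite (V - W)" using W Suc.prems finite_subset by auto
  have "card (V - W) = k * g" using W Suc.prems fW by (simp add: card_Diff_subset)
  then obtain F where F: "feasible s (V - W) F" "{} \<in> F" "card F \<le> k * b + 1" using Suc.IH[OF fW(2)] by blast
  obtain G where G: "feasible s W G" "{} \<in> G" "card G \<le> b + 1" using block[OF fW(1) W(2)] by blast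
  have "V - W \<union> W = V" using W by auto
  then show ?case using feasible_Un[OF fW(2,1) F(1) G(1) F(2) G(2)] F G
    by (intro exI[of _ "F \<union> G"]) auto
qed

text \<open>The points left over when g does not divide the size are put into one more block that
  may overlap the others; its cost b is independent of the size and vanishes in the limit.\<close>

lemma feasible_cover:
  assumes block: "\<And>V :: nat set. finite V \<Longrightarrow> card V = g \<Longrightarrow> \<exists>F. feasible s V F \<and> {} \<in> F \<and> card F \<le> b + 1"
    and g: "1 \<le> g" and V: "finite V" "g \<le> card V"
  shows "\<exists>F. feasible s V F \<and> card F \<le> (card V div g + 1) * b + 1"
proof -
  let ?k = "card V div g"
  have "?k * g \<le> card V" by (rule div_times_less_eq_dividend)
  then obtain W where W: "W \<subseteq> V" "card W = ?k * g" by (metis obtain_subset_with_card_n)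
  have fW: "finite W" using W V finite_subset by blast
  have "card (V - W) = card V mod g"
    using W fW by (simp add: card_Diff_subset minus_div_mult_eq_mod)
  also have "\<dots> \<le> g" using g by (simp add: less_imp_le)
  finally have "card (V - W) \<le> g" .
  then obtain X where X: "V - W \<subseteq> X" "X \<subseteq> V" "card X = g"
    using exists_subset_between[of "V - W" g V] V by blast
  have fX: "finite X" using X V finite_subset by blast
  obtain F where F: "feasible s W F" "{} \<in> F" "card F \<le> ?k * b + 1" using feasible_tiling[OF block fW W(2)] by blast
  obtain G where G: "feasible s X G" "{} \<in> G" "card G \<le> b + 1" using block[OF fX X(3)] by blast
  have "W \<union> X = V" using W X by auto
  then show ?thesis using feasible_Un[OF fW fX F(1) G(1) F(2) G(2)] F G
    by (intro exI[of _ "F \<union> G"]) auto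
qed

text \<open>b bounds the number of nonempty sets in a block of g points, and t is the resulting cost
  per point. A tiling meets the lower bound exactly; for other n, rounding and one extra block
  change the value by a bounded amount.\<close>

lemma mfun_exact_and_limit:
  assumes g: "1 \<le> g" and t: "0 \<le> t" "real b = real g * t"
    and block: "\<And>V :: nat set. finite V \<Longrightarrow> card V = g \<Longrightarrow> \<exists>F. feasible s V F \<and> {} \<in> F \<and> card F \<le> b + 1"
    and large: "\<And>V F. finite V \<Longrightarrow> V \<noteq> {} \<Longrightarrow> feasible s V F \<Longrightarrow> real (card V) * t + 1 \<le> real (card F)"
  shows "\<forall>n::nat. 1 \<le> n \<and> g dvd n \<longrightarrow> real (mfun n s) = t * real n"
    "(\<lambda>n. real (mfun n s) / real n) \<longlonglongrightarrow> t"
proof -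
  have lower: "m < card F" if "1 \<le> n" "real m \<le> real n * t" "finite V" "card V = n" "feasible s V F" for n m V F
  proof -
    have "V \<noteq> {}" using that by auto
    then have "real m < real (card F)" using large[of V F] that by force
    then show ?thesis by simp
  qed
  show "\<forall>n::nat. 1 \<le> n \<and> g dvd n \<longrightarrow> real (mfun n s) = t * real n"
  proof (intro allI impI, elim conjE)
    fix n :: nat assume n: "1 \<le> n" "g dvd n"
    then obtain k where k: "n = k * g" by (metis dvd_def mult.commute)
    have kb: "real (k * b) = real n * t" using t(2) by (simp add: k)
    obtain F where F: "feasible s {..<n} F" "card F \<le> k * b + 1"
      using feasible_tiling[where V = "{..<n}" and k = k, OF block] k by auto
    note B = mfun_bounds[OF n(1) lower[OF n(1) eq_refl[OF kb]], where V = "{..<n}" and F = F]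
    have "k * b \<le> mfun n s" "mfun n s < card F" using B F(1) by simp_all
    then have "mfun n s = k * b" using F(2) by linarith
    then show "real (mfun n s) = t * real n" using kb by simp
  qed
  have bounds: "t - 1 / real n \<le> real (mfun n s) / real n \<and> real (mfun n s) / real n \<le> t + real b / real n"
    if n: "g \<le> n" for n
  proof -
    have n1: "1 \<le> n" using n g by linarith
    obtain F where F: "feasible s {..<n} F" "card F \<le> (n div g + 1) * b + 1"
      using feasible_cover[where V = "{..<n}", OF block g] n by auto
    define m where "m = nat \<lfloor>real n * t\<rfloor>"
    have m: "real m \<le> real n * t" "real n * t - 1 \<le> real m"
      using t(1) by (auto simp: m_def)
    note B = mfun_bounds[OF n1 lower[OF n1 m(1)], where V = "{..<n}" and F = F]
    have "m \<le> mfun n s" and up: "mfun n s < card F" using B F(1) by simp_all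
    then have lo: "real n * t - 1 \<le> real (mfun n s)" using m(2) by linarith
    have "mfun n s \<le> (n div g + 1) * b" using up F(2) by linarith
    then have "real (mfun n s) \<le> real ((n div g + 1) * b)" by (simp only: of_nat_le_iff)
    also have "\<dots> = real (n div g * g) * t + real b" using t(2) by (simp add: algebra_simps)
    also have "\<dots> \<le> real n * t + real b"
      using t(1) by (intro add_right_mono mult_right_mono) (simp_all only: of_nat_le_iff div_times_less_eq_dividend)
    finally have "real (mfun n s) \<le> real n * t + real b" .
    moreover have "t - 1 / real n = (real n * t - 1) / real n" "t + real b / real n = (real n * t + real b) / real n"
      using n1 by (simp_all add: diff_divide_distrib add_divide_distrib)
    ultimately show ?thesis using lo by (simp only: divide_right_mono of_nat_0_le_iff)
  qed
  show "(\<lambda>n. real (mfun n s) / real n) \<longlonglongrightarrow> t"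
  proof (rule tendsto_sandwich)
    show "(\<lambda>n. t - 1 / real n) \<longlonglongrightarrow> t" "(\<lambda>n. t + real b / real n) \<longlonglongrightarrow> t" by real_asymp+
    show "\<forall>\<^sub>F n in sequentially. t - 1 / real n \<le> real (mfun n s) / real n"
      "\<forall>\<^sub>F n in sequentially. real (mfun n s) / real n \<le> t + real b / real n"
      using bounds by (auto simp: eventually_sequentially)
  qed
qed

lemma feasible_card_ge:
  assumes d: "50 \<le> d" and c: "1 \<le> c" "c \<le> d"
    and V: "finite V" "V \<noteq> {}" and F: "feasible (2 ^ (d - 1) - c) V F"
  shows "real (card V) * ((2 ^ d - real c) / real d - (if c = d then 1 / 2 else 0) / real d) + 1 \<le> real (card F)"
proof -
  note F' = F[unfolded feasible_def, THEN conjunct1] F[unfolded feasible_def, THEN conjunct2, THEN conjunct1]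
    F[unfolded feasible_def, THEN conjunct2, THEN conjunct2]
  have "2 ^ (d - 1) < card {A \<in> F. x \<in> A} + c" if "x \<in> V" for x
    using bspec[OF F'(3) that] by linarith
  then interpret dense_family V F d c by (intro dense_family.intro V(1) F'(1,2) d c)
  show ?thesis using card_ge[OF V(2)] by (simp add: tau_def)
qed

section \<open>Extremal families\<close>

lemma card_containing_removed:
  assumes "finite V" "x \<in> V" "finite R"
  shows "2 ^ (card V - 1) \<le> card {A \<in> Pow V - R. x \<in> A} + card {A \<in> R. x \<in> A}"
proof -
  have "2 ^ (card V - 1) = card {A. A \<subseteq> V \<and> x \<in> A}"
    using card_subsets_containing[OF assms(1,2)] by simp
  also have "\<dots> \<le> card ({A \<in> Pow V - R. x \<in> A} \<union> {A \<in> R. x \<in> A})"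
    using assms by (intro card_mono) auto
  also have "\<dots> \<le> card {A \<in> Pow V - R. x \<in> A} + card {A \<in> R. x \<in> A}"
    by (rule card_Un_le)
  finally show ?thesis .
qed

text \<open>A hereditary family obtained from the cube by removing c - 1 sets, whichever they are,
  takes at most c - 1 sets from each point and so keeps all degrees above
  \<open>2 ^ (d - 1) - c\<close>.\<close>

lemma exists_block:
  assumes d: "1 \<le> d" and c: "1 \<le> c" "c \<le> d" and V: "finite V" "card V = d"
  shows "\<exists>F. feasible (2 ^ (d - 1) - c) V F \<and> {} \<in> F \<and> card F \<le> (2 ^ d - c) + 1"
proof -
  have d2: "d < 2 ^ d" "d - 1 < 2 ^ (d - 1)" by (rule less_exp)+
  have h: "hereditary {{} :: nat set}" "hereditary (Pow V)" by (auto simp: hereditary_def)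
  have fP: "finite (Pow V)" and "card (Pow V) = 2 ^ d" using V by (simp_all add: card_Pow)
  moreover have "2 ^ d - c + 1 \<le> 2 ^ d" using c d2 by linarith
  ultimately obtain G where G: "hereditary G" "{{}} \<subseteq> G" "G \<subseteq> Pow V" "card G = 2 ^ d - c + 1"
    using hereditary_between[OF h(1) _ _ _ h(2) fP, of "2 ^ d - c + 1"] by auto
  define R where "R = Pow V - G"
  have fR: "finite R" using fP by (simp add: R_def)
  have GR: "Pow V - R = G" using G(3) by (auto simp: R_def)
  have "card R = 2 ^ d - card G"
    unfolding R_def using G(3) fP V by (simp add: card_Diff_subset finite_subset card_Pow)
  then have cR: "card R = c - 1" using G(4) c d2 by linarith
  have "feasible (2 ^ (d - 1) - c) V G"
    unfolding feasible_def
  proof (intro conjI G ballI)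
    fix x assume x: "x \<in> V"
    have "card {A \<in> R. x \<in> A} \<le> card R" using fR by (intro card_mono) auto
    then have "2 ^ (d - 1) \<le> card {A \<in> G. x \<in> A} + (c - 1)"
      using card_containing_removed[OF V(1) x fR, unfolded V(2) GR] cR by linarith
    then show "2 ^ (d - 1) - c < card {A \<in> G. x \<in> A}" using c d2 by linarith
  qed
  then show ?thesis using G by (intro exI[of _ G]) auto
qed

text \<open>A cube without its top and without all but one of its coatoms: only the point avoided by
  the remaining coatom has too small a degree.\<close>
definition pruned_cube :: "nat set \<Rightarrow> nat \<Rightarrow> nat set set" where
  "pruned_cube V a = Pow V - insert V ((\<lambda>i. V - {i}) ` (V - {a}))"

lemma pruned_cube:
  assumes V: "finite V" "card V = d" and d: "3 \<le> d" and a: "a \<in> V"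
  shows "hereditary (pruned_cube V a)" "pruned_cube V a \<subseteq> Pow V" "{} \<in> pruned_cube V a" "{a} \<in> pruned_cube V a"
    "card (pruned_cube V a) = 2 ^ d - d"
    "x \<in> V \<Longrightarrow> 2 ^ (d - 1) \<le> card {A \<in> pruned_cube V a. x \<in> A} + (if x = a then d else d - 1)"
proof -
  let ?R = "insert V ((\<lambda>i. V - {i}) ` (V - {a}))"
  have fR: "finite ?R" using V by simp
  have big: "2 \<le> card A" if "A \<in> ?R" for A
    using that V d by (auto simp: card_Diff_subset)
  have "{} \<notin> ?R" "{a} \<notin> ?R" using big[of "{}"] big[of "{a}"] by auto
  then show "{} \<in> pruned_cube V a" "{a} \<in> pruned_cube V a" using a by (auto simp: pruned_cube_def)
  show "pruned_cube V a \<subseteq> Pow V" by (auto simp: pruned_cube_def)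
  show "hereditary (pruned_cube V a)"
    unfolding hereditary_def
  proof (intro ballI allI impI)
    fix A B assume A: "A \<in> pruned_cube V a" "B \<subseteq> A"
    then have AV: "A \<subseteq> V" "A \<notin> ?R" by (auto simp: pruned_cube_def)
    have "B \<notin> ?R"
    proof
      assume "B \<in> ?R"
      then consider "B = V" | i where "i \<in> V - {a}" "B = V - {i}" by blast
      then show False
      proof cases
        case 1
        then show False using A(2) AV by auto
      next
        case 2
        then have "A = V \<or> A = V - {i}" using A(2) AV(1) by blast
        then show False using AV(2) 2(1) by blast
      qed
    qed
    then show "B \<in> pruned_cube V a" using A(2) AV(1) by (auto simp: pruned_cube_def)
  qed
  have inj: "inj_on (\<lambda>i. V - {i}) V" by (rule inj_onI) auto
  have "card ?R = Suc (card ((\<lambda>i. V - {i}) ` (V - {a})))"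
    using V by (intro card_insert_disjoint) auto
  also have "\<dots> = Suc (card (V - {a}))" using inj_on_subset[OF inj, of "V - {a}"] by (simp add: card_image)
  also have "\<dots> = d" using card.remove[OF V(1) a] V(2) by simp
  finally have cR: "card ?R = d" .
  have "?R \<subseteq> Pow V" by auto
  then show "card (pruned_cube V a) = 2 ^ d - d"
    unfolding pruned_cube_def using card_Diff_subset[OF fR] cR V by (simp add: card_Pow)
  assume x: "x \<in> V"
  have "card {A \<in> ?R. x \<in> A} \<le> (if x = a then d else d - 1)"
  proof (cases "x = a")
    case True
    have "card {A \<in> ?R. x \<in> A} \<le> card ?R" using fR by (intro card_mono) auto
    then show ?thesis using True cR by simp
  next
    case False
    have "V - {x} \<in> ?R" using x False by blast
    then have "card (?R - {V - {x}}) = d - 1" using fR cR by simp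
    moreover have "card {A \<in> ?R. x \<in> A} \<le> card (?R - {V - {x}})" using fR by (intro card_mono) auto
    ultimately show ?thesis using False by simp
  qed
  then show "2 ^ (d - 1) \<le> card {A \<in> pruned_cube V a. x \<in> A} + (if x = a then d else d - 1)"
    using card_containing_removed[OF V(1) x fR, unfolded V(2)] unfolding pruned_cube_def by linarith
qed

text \<open>In each of two pruned cubes only the exceptional point is one set short, and the single
  edge \<open>{a, a'}\<close> repairs both. The size is 2(2^d - d), as the shared empty set and the
  edge cancel; this makes 2^d - d - 1/2 nonempty sets per block.\<close>

lemma exists_double_block:
  assumes d: "3 \<le> d" and V: "finite V" "card V = 2 * d"
  shows "\<exists>F. feasible (2 ^ (d - 1) - d) V F \<and> {} \<in> F \<and> card F \<le> (2 ^ (d + 1) - 2 * d - 1) + 1"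
proof -
  obtain B where B: "B \<subseteq> V" "card B = d" using V by (metis le_add1 mult_2 obtain_subset_with_card_n)
  define C where "C = V - B"
  have fB: "finite B" "finite C" using B V finite_subset by (auto simp: C_def)
  have cC: "card C = d" unfolding C_def using B V fB by (simp add: card_Diff_subset)
  have "B \<noteq> {}" "C \<noteq> {}" using B(2) cC d by auto
  then obtain a a' where a: "a \<in> B" "a' \<in> C" by blast
  note H = pruned_cube[OF fB(1) B(2) d a(1)]
  note H' = pruned_cube[OF fB(2) cC d a(2)]
  let ?H = "pruned_cube B a" and ?H' = "pruned_cube C a'"
  define F where "F = insert {a, a'} (?H \<union> ?H')"
  have fH: "finite ?H" "finite ?H'" using H(2) H'(2) fB finite_subset by (metis finite_Pow_iff)+
  have fF: "finite F" using fH by (simp add: F_def)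
  have BC: "B \<inter> C = {}" "V = B \<union> C" using B by (auto simp: C_def)
  \<comment> \<open>This keeps the natural number \<open>2 ^ (d - 1) - d\<close> from being
    truncated.\<close>
  have d1: "d \<le> 2 ^ (d - 1)" using less_exp[of "d - 1"] by linarith
  have "{a, a'} \<notin> Pow B" and "{a, a'} \<notin> Pow C" using a BC(1) by auto
  note edge = contra_subsetD[OF H(2) this(1)] contra_subsetD[OF H'(2) this(2)]
  have "hereditary F"
    unfolding hereditary_def
  proof (intro ballI allI impI)
    fix A S assume A: "A \<in> F" "S \<subseteq> A"
    show "S \<in> F"
    proof (cases "A = {a, a'}")
      case True
      then have "S \<subseteq> {a, a'}" using A(2) by simp
      then have "S = {} \<or> S = {a} \<or> S = {a'} \<or> S = {a, a'}"
        by (cases "a \<in> S"; cases "a' \<in> S") auto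
      moreover have "{} \<in> F" "{a} \<in> F" "{a'} \<in> F" "{a, a'} \<in> F"
        using H(3,4) H'(4) by (simp_all add: F_def)
      ultimately show ?thesis by metis
    next
      case False
      then have "A \<in> ?H \<or> A \<in> ?H'" using A(1) by (simp add: F_def)
      then have "S \<in> ?H \<or> S \<in> ?H'"
        using hereditaryD[OF H(1) _ A(2)] hereditaryD[OF H'(1) _ A(2)] by metis
      then show ?thesis by (simp add: F_def)
    qed
  qed
  moreover have "F \<subseteq> Pow V" using H(2) H'(2) a BC by (auto simp: F_def)
  moreover have "2 ^ (d - 1) - d < card {A \<in> F. x \<in> A}" if x: "x \<in> V" for x
  proof -
    have deg: "2 ^ (d - 1) - d < card {A \<in> F. x \<in> A}"
      if K: "K \<subseteq> F" "{a, a'} \<notin> K" "finite K"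
        and k: "2 ^ (d - 1) \<le> card {A \<in> K. x \<in> A} + (if x = b then d else d - 1)"
        and b: "b \<in> {a, a'}" for K b
    proof (cases "x = b")
      case True
      have "insert {a, a'} {A \<in> K. x \<in> A} \<subseteq> {A \<in> F. x \<in> A}"
        using K b True by (auto simp: F_def)
      then have "card (insert {a, a'} {A \<in> K. x \<in> A}) \<le> card {A \<in> F. x \<in> A}"
        using fF by (intro card_mono) auto
      then show ?thesis using K k True by simp
    next
      case False
      have "card {A \<in> K. x \<in> A} \<le> card {A \<in> F. x \<in> A}" using K fF by (intro card_mono) auto
      then show ?thesis using k False d d1 by simp
    qed
    show ?thesis
    proof (cases "x \<in> B")
      case True
      show ?thesis by (rule deg[OF _ edge(1) fH(1) H(6)[OF True]]) (auto simp: F_def)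
    next
      case False
      then have "x \<in> C" using x BC by blast
      show ?thesis by (rule deg[OF _ edge(2) fH(2) H'(6)[OF \<open>x \<in> C\<close>]]) (auto simp: F_def)
    qed
  qed
  ultimately have "feasible (2 ^ (d - 1) - d) V F" by (simp add: feasible_def)
  moreover have "{} \<in> F" using H(3) by (simp add: F_def)
  moreover have "card F \<le> (2 ^ (d + 1) - 2 * d - 1) + 1"
  proof -
    have "card {{} :: nat set} \<le> card (?H \<inter> ?H')" using H(3) H'(3) fH by (intro card_mono) auto
    then have "card (?H \<union> ?H') + 1 \<le> (2 ^ d - d) + (2 ^ d - d)"
      using card_Un_Int[OF fH] H(5) H'(5) by simp
    moreover have "card F \<le> card (?H \<union> ?H') + 1" unfolding F_def using fH by (simp add: card_insert_if)
    ultimately have "card F \<le> (2 ^ d - d) + (2 ^ d - d)" by linarith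
    then show ?thesis by simp
  qed
  ultimately show ?thesis by blast
qed

theorem mainTheorem2:
  fixes d :: nat
  assumes "d \<ge> 50"
  shows "(\<forall>n::nat. n \<ge> 1 \<and> 2 * d dvd n \<longrightarrow>
            real (mfun n (2 ^ (d - 1) - d)) = (2 ^ d - real d - 1 / 2) / real d * real n)
       \<and> ((\<lambda>n. real (mfun n (2 ^ (d - 1) - d)) / real n)
            \<longlonglongrightarrow> (2 ^ d - real d - 1 / 2) / real d)
       \<and> (\<forall>c::nat. 1 \<le> c \<and> c \<le> d - 1 \<longrightarrow>
            (\<forall>n::nat. n \<ge> 1 \<and> d dvd n \<longrightarrow>
               real (mfun n (2 ^ (d - 1) - c)) = (2 ^ d - real c) / real d * real n)
            \<and> ((\<lambda>n. real (mfun n (2 ^ (d - 1) - c)) / real n)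
                 \<longlonglongrightarrow> (2 ^ d - real c) / real d))"
proof -
  have d1: "d + 1 \<le> 2 ^ d" using less_exp[of d] by linarith
  then have "real (d + 1) \<le> real (2 ^ d)" by (simp only: of_nat_le_iff)
  then have d1r: "real d + 1 \<le> 2 ^ d" by simp
  have "\<exists>F. feasible (2 ^ (d - 1) - d) V F \<and> {} \<in> F \<and> card F \<le> (2 ^ (d + 1) - 2 * d - 1) + 1"
    if "finite V" "card V = 2 * d" for V
    using exists_double_block[OF _ that] assms by simp
  moreover have "real (card V) * ((2 ^ d - real d - 1 / 2) / real d) + 1 \<le> real (card F)"
    if "finite V" "V \<noteq> {}" "feasible (2 ^ (d - 1) - d) V F" for V F
    using feasible_card_ge[OF assms _ order_refl that] assms by (simp add: diff_divide_distrib)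
  \<comment> \<open>A double block on 2d points has this many nonempty sets; the half per block is
    why 2d rather than d has to divide n.\<close>
  moreover have "real (2 ^ (d + 1) - 2 * d - 1) = real (2 * d) * ((2 ^ d - real d - 1 / 2) / real d)"
    using d1 assms by (simp add: of_nat_diff field_simps)
  moreover have "0 \<le> (2 ^ d - real d - 1 / 2) / real d" using d1r by simp
  ultimately have A:
    "\<forall>n::nat. 1 \<le> n \<and> 2 * d dvd n \<longrightarrow> real (mfun n (2 ^ (d - 1) - d)) = (2 ^ d - real d - 1 / 2) / real d * real n"
    "(\<lambda>n. real (mfun n (2 ^ (d - 1) - d)) / real n) \<longlonglongrightarrow> (2 ^ d - real d - 1 / 2) / real d"
    using mfun_exact_and_limit[where g = "2 * d" and t = "(2 ^ d - real d - 1 / 2) / real d"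
        and b = "2 ^ (d + 1) - 2 * d - 1" and s = "2 ^ (d - 1) - d"] assms by simp_all
  have "(\<forall>n::nat. 1 \<le> n \<and> d dvd n \<longrightarrow> real (mfun n (2 ^ (d - 1) - c)) = (2 ^ d - real c) / real d * real n)
      \<and> ((\<lambda>n. real (mfun n (2 ^ (d - 1) - c)) / real n) \<longlonglongrightarrow> (2 ^ d - real c) / real d)"
    if c: "1 \<le> c" "c \<le> d - 1" for c
  proof -
    have cd: "c \<le> d" "c \<noteq> d" using c assms by auto
    have 1: "\<exists>F. feasible (2 ^ (d - 1) - c) V F \<and> {} \<in> F \<and> card F \<le> (2 ^ d - c) + 1"
      if "finite V" "card V = d" for V
      using exists_block[OF _ c(1) cd(1) that] assms by simp
    have 2: "real (card V) * ((2 ^ d - real c) / real d) + 1 \<le> real (card F)"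
      if "finite V" "V \<noteq> {}" "feasible (2 ^ (d - 1) - c) V F" for V F
      using feasible_card_ge[OF assms c(1) cd(1) that] cd(2) by simp
    have 3: "real (2 ^ d - c) = real d * ((2 ^ d - real c) / real d)"
      using d1 cd assms by (simp add: of_nat_diff)
    have "real c \<le> real d" using cd(1) by simp
    then have 4: "0 \<le> (2 ^ d - real c) / real d" using d1r by (intro divide_nonneg_nonneg) linarith+
    have g: "1 \<le> d" using assms by simp
    show ?thesis using mfun_exact_and_limit[OF g 4 3 1 2] by blast
  qed
  then show ?thesis using A by blast
qed

end
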